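(* Let $B(t)=S(p+qt)$, where $S\in C^0(\mathbb{T}^m,\mathrm{Sym}(2,\mathbb{R}))$, $p\in\mathbb{R}^m$, and $q=(q_1,\dots,q_m)\in\mathbb{R}^m$ has components linearly independent over $\mathbb{Q}$ (a two-dimensional quasi-periodic system). Then $\pi\,\mathcal{I}(B)=R(B)$, where $\mathcal{I}(B)$ is the mean index and $R(B)$ is the rotation number.
   Context: Here $d=1$: $J=\begin{pmatrix}0&-1\\1&0\end{pmatrix}$, $I$ is the $2\times2$ identity, $\mathrm{Sp}(2)=\{M\in GL(\mathbb{R}^{2}): M^TJM=J\}$, $\mathbb{U}$ is the unit circle in $\mathbb{C}$, $\mathbb{T}^m$ the $m$-torus, and $\gamma$ is the fundamental solution: $\dot\gamma(t)=JB(t)\gamma(t)$, $\gamma(0)=I$. Maslov-type index: let $\mathrm{Sp}(2)^0_1=\{M\in\mathrm{Sp}(2):\det(M-I)=0\}$, a codimension-one hypersurface co-oriented at $M$ by the direction $\frac{d}{dt}Me^{tJ}|_{t=0}$. For a continuous path $\gamma:[0,T]\to\mathrm{Sp}(2)$ with $\gamma(0)=I$, let $\iota(I,\gamma,[0,T])\in\mathbb{Z}$ be the intersection number of the path $t\mapsto e^{-\epsilon J}\gamma(t)$, $t\in[0,T]$, with $\mathrm{Sp}(2)^0_1$, for $\epsilon>0$ sufficiently small, and $i_1(\gamma,[0,T])=\iota(I,\gamma,[0,T])-1$. Mean index: $\mathcal{I}_U(B)=\limsup_{l\to+\infty}\frac{i_1(\gamma,[0,l])}{l}$, $\mathcal{I}_L(B)=\liminf_{l\to+\infty}\frac{i_1(\gamma,[0,l])}{l}$,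 $\mathcal{I}(B)=[\mathcal{I}_L(B),\mathcal{I}_U(B)]$, identified with a number when it is a single point (which is the case for quasi-periodic systems). Rotation number: let $z=(u,v)^T$ be a nonzero solution of $\dot z=JB(t)z$, $\theta_0$ an argument of $u(0)+iv(0)$, and $\theta:\mathbb{R}\to\mathbb{R}$ the unique continuous function such that $\theta(0)=\theta_0$ and $\theta(t)$ is an argument of $u(t)+iv(t)$ for every $t$. Then $R(B)=\lim_{t\to+\infty}\theta(t)/t$. *)

theory Defs
  imports "HOL-Analysis.Analysis"
begin

definition J :: "real^2^2" where
  "J = vector [vector [0, -1], vector [1, 0]]"

text \<open>The exponential of \<open>t J\<close>, in closed form since \<open>J ** J = - mat 1\<close>; the two lemmas
  below characterise it as the solution of \<open>X' = J X\<close>, \<open>X 0 = I\<close>.\<close>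

definition expJ :: "real \<Rightarrow> real^2^2" where
  "expJ t = cos t *\<^sub>R mat 1 + sin t *\<^sub>R J"

lemma J_square: "J ** J = - mat 1"
  by (simp add: J_def vec_eq_iff matrix_matrix_mult_def mat_def sum_2 forall_2)

lemma expJ_0: "expJ 0 = mat 1"
  by (simp add: expJ_def)

lemma expJ_has_vector_derivative: "(expJ has_vector_derivative J ** expJ t) (at t)"
proof -
  have "J ** expJ t = - sin t *\<^sub>R mat 1 + cos t *\<^sub>R J"
    by (simp add: expJ_def J_def vec_eq_iff matrix_matrix_mult_def mat_def sum_2 forall_2)
  then show ?thesis
    unfolding expJ_def [abs_def]
    by (auto intro!: derivative_eq_intros)
qed

definition Sp2 :: "(real^2^2) set" where
  "Sp2 = {M. invertible M \<and> transpose M ** J ** M = J}"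

definition Sp2_01 :: "(real^2^2) set" where
  "Sp2_01 = {M \<in> Sp2. det (M - mat 1) = 0}"

subsection \<open>Intersection number with the co-oriented hypersurface\<close>

text \<open>The function \<open>M \<mapsto> det (M - I)\<close> defines the hypersurface. On \<open>Sp2\<close> it equals
  \<open>2 - tr M\<close>, whose derivative in the co-orienting direction \<open>M J\<close> is nonzero at every point of
  the hypersurface other than its only singular point \<open>I\<close>, where the whole differential vanishes.
  Hence a crossing is transverse (and through a regular point) iff the derivative of
  \<open>det (\<beta> s - I)\<close> is nonzero there, and it is positive iff this derivative has the same sign
  as the derivative in the co-orienting direction.\<close>

definition transverse_crossing :: "(real \<Rightarrow> real^2^2) \<Rightarrow> real \<Rightarrow> bool" where
  "transverse_crossing \<beta> t \<longleftrightarrow> deriv (\<lambda>s. det (\<beta> s - mat 1)) t \<noteq> 0"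

definition crossing_sign :: "(real \<Rightarrow> real^2^2) \<Rightarrow> real \<Rightarrow> real" where
  "crossing_sign \<beta> t =
     sgn (deriv (\<lambda>s. det (\<beta> s - mat 1)) t) * sgn (deriv (\<lambda>s. det (\<beta> t ** expJ s - mat 1)) 0)"

definition crossing_times :: "(real \<Rightarrow> real^2^2) \<Rightarrow> real set" where
  "crossing_times \<beta> = {t \<in> {0..1}. \<beta> t \<in> Sp2_01}"

text \<open>A continuous path with end points off the hypersurface is deformed in \<open>Sp2\<close>, with fixed
  end points, to a transverse path of class \<open>C\<^sup>1\<close>, whose crossings are counted with sign. Paths
  are parametrised by the unit interval, as in the library.\<close>

definition has_intersection_number :: "(real \<Rightarrow> real^2^2) \<Rightarrow> int \<Rightarrow> bool" where
  "has_intersection_number \<alpha> n \<longleftrightarrow>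
     pathstart \<alpha> \<notin> Sp2_01 \<and> pathfinish \<alpha> \<notin> Sp2_01 \<and>
     (\<exists>\<beta>. homotopic_paths Sp2 \<alpha> \<beta> \<and> \<beta> C1_differentiable_on {0..1} \<and>
          finite (crossing_times \<beta>) \<and>
          (\<forall>t\<in>crossing_times \<beta>. transverse_crossing \<beta> t) \<and>
          real_of_int n = (\<Sum>t\<in>crossing_times \<beta>. crossing_sign \<beta> t))"

subsection \<open>Maslov-type index and mean index\<close>

text \<open>The path \<open>t \<mapsto> exp (- \<epsilon> J) \<gamma> t\<close> on \<open>[0, T]\<close>, rescaled to the unit interval.\<close>

definition perturbed_path :: "(real \<Rightarrow> real^2^2) \<Rightarrow> real \<Rightarrow> real \<Rightarrow> real \<Rightarrow> real^2^2" where
  "perturbed_path \<gamma> T \<epsilon> = (\<lambda>s. expJ (- \<epsilon>) ** \<gamma> (T * s))"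

definition iota :: "(real \<Rightarrow> real^2^2) \<Rightarrow> real \<Rightarrow> int" where
  "iota \<gamma> T =
     (THE n. eventually (\<lambda>\<epsilon>. has_intersection_number (perturbed_path \<gamma> T \<epsilon>) n) (at_right 0))"

definition maslov_index :: "(real \<Rightarrow> real^2^2) \<Rightarrow> real \<Rightarrow> int" where
  "maslov_index \<gamma> T = iota \<gamma> T - 1"

definition mean_index_upper :: "(real \<Rightarrow> real^2^2) \<Rightarrow> ereal" where
  "mean_index_upper \<gamma> = Limsup at_top (\<lambda>l::real. ereal (real_of_int (maslov_index \<gamma> l) / l))"

definition mean_index_lower :: "(real \<Rightarrow> real^2^2) \<Rightarrow> ereal" where
  "mean_index_lower \<gamma> = Liminf at_top (\<lambda>l::real. ereal (real_of_int (maslov_index \<gamma> l) / l))"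

definition mean_index :: "(real \<Rightarrow> real^2^2) \<Rightarrow> ereal set" where
  "mean_index \<gamma> = {mean_index_lower \<gamma> .. mean_index_upper \<gamma>}"

subsection \<open>Linear Hamiltonian systems and the rotation number\<close>

definition fundamental_solution :: "(real \<Rightarrow> real^2^2) \<Rightarrow> (real \<Rightarrow> real^2^2) \<Rightarrow> bool" where
  "fundamental_solution B \<gamma> \<longleftrightarrow>
     (\<forall>t. (\<gamma> has_vector_derivative J ** B t ** \<gamma> t) (at t)) \<and> \<gamma> 0 = mat 1"

definition nonzero_solution :: "(real \<Rightarrow> real^2^2) \<Rightarrow> (real \<Rightarrow> real^2) \<Rightarrow> bool" where
  "nonzero_solution B z \<longleftrightarrow>
     (\<forall>t. (z has_vector_derivative (J ** B t) *v z t) (at t)) \<and> (\<exists>t. z t \<noteq> 0)"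

definition argument_lift :: "(real \<Rightarrow> real^2) \<Rightarrow> (real \<Rightarrow> real) \<Rightarrow> bool" where
  "argument_lift z \<theta> \<longleftrightarrow>
     continuous_on UNIV \<theta> \<and> (\<forall>t. is_Arg (Complex (z t $ 1) (z t $ 2)) (\<theta> t))"

text \<open>The limit is the same number for every nonzero solution and every choice of \<open>\<theta> 0\<close>.\<close>

definition has_rotation_number :: "(real \<Rightarrow> real^2^2) \<Rightarrow> real \<Rightarrow> bool" where
  "has_rotation_number B R \<longleftrightarrow>
     (\<forall>z \<theta>. nonzero_solution B z \<longrightarrow> argument_lift z \<theta> \<longrightarrow>
        ((\<lambda>t. \<theta> t / t) \<longlongrightarrow> R) at_top)"

subsection \<open>Quasi-periodic coefficients\<close>

text \<open>Functions on the torus are functions of period 1 in every coordinate; another choice of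
  period amounts to rescaling \<open>p\<close> and \<open>q\<close> by a common factor.\<close>

definition continuous_on_torus :: "(real^'m \<Rightarrow> 'a::topological_space) \<Rightarrow> bool" where
  "continuous_on_torus S \<longleftrightarrow> continuous_on UNIV S \<and> (\<forall>x i. S (x + axis i 1) = S x)"

definition rationally_independent :: "real^'m \<Rightarrow> bool" where
  "rationally_independent q \<longleftrightarrow>
     (\<forall>c :: 'm \<Rightarrow> rat. (\<Sum>i\<in>UNIV. of_rat (c i) * q $ i) = 0 \<longrightarrow> (\<forall>i. c i = 0))"

end

theory Submission
  imports Defs "HOL-Complex_Analysis.Riemann_Mapping"
begin

text \<open>A matrix \<open>M\<close> acts on \<open>\<complex>\<close> as \<open>z \<mapsto> a z + b z\<^sup>*\<close>, and \<open>M \<in> Sp2\<close> iff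
  \<open>\<bar>a\<bar>\<^sup>2 - \<bar>b\<bar>\<^sup>2 = 1\<close>, in which case \<open>det (M - I) = 2 - 2 Re a\<close>. Numbering the components of the
  complement of the lifted hypersurface in the universal cover turns the intersection number into a
  function of the end points of a lift of the argument of \<open>a\<close>, so the Maslov-type index of
  \<open>\<gamma>\<close> on \<open>[0, T]\<close> differs from \<open>\<phi> T / \<pi>\<close> by a bounded amount, where \<open>\<phi>\<close> is the continuous
  argument of \<open>a\<close> along \<open>\<gamma>\<close>. Since \<open>\<bar>b\<bar> < \<bar>a\<bar>\<close>, the argument of every solution also stays within
  bounded distance of \<open>\<phi>\<close>. Finally \<open>\<phi> t / t\<close> converges: the displacement of \<open>\<phi>\<close> over a window of
  fixed length changes by a bounded amount when the window is moved by an almost period of the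
  coefficients, and such almost periods are relatively dense.\<close>

subsection \<open>Complex coordinates on \<open>Sp2\<close>\<close>

text \<open>\<open>iota\<close> is a definite description over a homotopy class, so the intersection
  number must be proved both unique and existent. Uniqueness is homotopy invariance; existence needs
  an explicit transverse path of class C1. The universal cover of \<open>Sp2\<close> has global
  coordinates in the vector space of pairs (argument of a, b), so a path can be replaced by any
  other one with the same lifted end points through a straight-line homotopy. The singular point I
  is no obstacle to counting: |a| is at least 1 on \<open>Sp2\<close>, which rules out a transverse
  crossing there.

  All comparisons of angles rest on one principle: if one term of a sum dominates the other at all
  times, the argument of the sum follows that of the dominant term with an error below pi, however
  long the time interval. This makes the argument of a additive along products of paths up to a
  bounded error. Solutions may grow exponentially, so a system and its translate by an almost period
  can be compared only on windows of bounded length T, with a tolerance that depends on T. The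
  angular error is nevertheless below 4 pi for every T, hence negligible relative to T once T is
  large.\<close>

definition clin :: "real^2^2 \<Rightarrow> complex" where
  "clin M = Complex ((M$1$1 + M$2$2) / 2) ((M$2$1 - M$1$2) / 2)"

definition alin :: "real^2^2 \<Rightarrow> complex" where
  "alin M = Complex ((M$1$1 - M$2$2) / 2) ((M$2$1 + M$1$2) / 2)"

definition rmat :: "complex \<Rightarrow> complex \<Rightarrow> real^2^2" where
  "rmat a b = vector [vector [Re a + Re b, Im b - Im a], vector [Im a + Im b, Re a - Re b]]"

definition zvec :: "real^2 \<Rightarrow> complex" where
  "zvec z = Complex (z$1) (z$2)"

lemma clin_rmat [simp]: "clin (rmat a b) = a"
  by (simp add: clin_def rmat_def complex_eq_iff)

lemma alin_rmat [simp]: "alin (rmat a b) = b"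
  by (simp add: alin_def rmat_def complex_eq_iff)

lemma rmat_clin_alin [simp]: "rmat (clin M) (alin M) = M"
  by (simp add: clin_def alin_def rmat_def vec_eq_iff forall_2 field_simps)

lemma rmat_eq_iff: "rmat a b = M \<longleftrightarrow> a = clin M \<and> b = alin M"
  by (metis clin_rmat alin_rmat rmat_clin_alin)

lemma clin_mult: "clin (M ** N) = clin M * clin N + alin M * cnj (alin N)"
  by (simp add: clin_def alin_def matrix_matrix_mult_def sum_2 complex_eq_iff field_simps)

lemma alin_mult: "alin (M ** N) = clin M * alin N + alin M * cnj (clin N)"
  by (simp add: clin_def alin_def matrix_matrix_mult_def sum_2 complex_eq_iff field_simps)

lemma zvec_mult: "zvec (M *v z) = clin M * zvec z + alin M * cnj (zvec z)"
  by (simp add: clin_def alin_def zvec_def matrix_vector_mult_def sum_2 complex_eq_iff field_simps)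

lemma clin_mat_1 [simp]: "clin (mat 1) = 1" and alin_mat_1 [simp]: "alin (mat 1) = 0"
  by (simp_all add: clin_def alin_def mat_def complex_eq_iff)

lemma clin_J [simp]: "clin J = \<i>" and alin_J [simp]: "alin J = 0"
  by (simp_all add: clin_def alin_def J_def complex_eq_iff)

lemma bounded_linear_clin: "bounded_linear clin"
  unfolding linear_conv_bounded_linear [symmetric]
  by (rule linearI) (simp_all add: clin_def complex_eq_iff field_simps)

lemma bounded_linear_alin: "bounded_linear alin"
  unfolding linear_conv_bounded_linear [symmetric]
  by (rule linearI) (simp_all add: alin_def complex_eq_iff field_simps)

lemma bounded_linear_zvec: "bounded_linear zvec"
  unfolding linear_conv_bounded_linear [symmetric]
  by (rule linearI) (simp_all add: zvec_def complex_eq_iff field_simps)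

lemma bounded_linear_rmat: "bounded_linear (\<lambda>(a, b). rmat a b)"
  unfolding linear_conv_bounded_linear [symmetric]
  by (rule linearI) (auto simp: rmat_def vec_eq_iff forall_2 field_simps split: prod.splits)

lemma zvec_eq_0_iff: "zvec z = 0 \<longleftrightarrow> z = 0"
  by (simp add: zvec_def complex_eq_iff vec_eq_iff forall_2)

lemma clin_expJ [simp]: "clin (expJ t) = cis t" and alin_expJ [simp]: "alin (expJ t) = 0"
  by (simp_all add: clin_def alin_def expJ_def J_def mat_def complex_eq_iff)

lemma det_rmat: "det M = (norm (clin M))\<^sup>2 - (norm (alin M))\<^sup>2"
  unfolding det_2 cmod_power2 by (simp add: clin_def alin_def power2_eq_square field_simps)

lemma mem_Sp2_iff: "M \<in> Sp2 \<longleftrightarrow> (norm (clin M))\<^sup>2 = 1 + (norm (alin M))\<^sup>2"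
proof -
  have "transpose M ** J ** M = det M *\<^sub>R J"
    by (simp add: det_2 J_def transpose_def matrix_matrix_mult_def sum_2 vec_eq_iff forall_2 algebra_simps)
  moreover have "det M *\<^sub>R J = J \<longleftrightarrow> det M = 1"
    by (simp add: J_def vec_eq_iff forall_2)
  ultimately have "M \<in> Sp2 \<longleftrightarrow> det M = 1"
    by (auto simp: Sp2_def invertible_det_nz)
  then show ?thesis
    by (auto simp: det_rmat)
qed

lemma Sp2_norm_clin_ge_1: "M \<in> Sp2 \<Longrightarrow> norm (clin M) \<ge> 1"
  unfolding mem_Sp2_iff
  by (metis le_add_same_cancel1 norm_ge_zero one_power2 power2_le_imp_le zero_le_power2)

lemma det_minus_mat_1: "det (M - mat 1) = 1 + det M - 2 * Re (clin M)"
  by (simp add: det_2 clin_def mat_def field_simps)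

lemma det_minus_mat_1_Sp2: "M \<in> Sp2 \<Longrightarrow> det (M - mat 1) = 2 - 2 * Re (clin M)"
  using det_minus_mat_1 [of M] det_rmat [of M] by (simp add: mem_Sp2_iff)

lemma mem_Sp2_01_iff: "M \<in> Sp2_01 \<longleftrightarrow> M \<in> Sp2 \<and> Re (clin M) = 1"
  by (auto simp: Sp2_01_def det_minus_mat_1_Sp2)

lemma expJ_in_Sp2: "expJ t \<in> Sp2"
  by (simp add: mem_Sp2_iff)

lemma Sp2_mult:
  assumes "M \<in> Sp2" "N \<in> Sp2"
  shows "M ** N \<in> Sp2"
proof -
  have "det M = 1" "det N = 1" using assms by (auto simp: mem_Sp2_iff det_rmat)
  then have "det (M ** N) = 1" by (simp add: det_mul)
  then show ?thesis by (simp add: mem_Sp2_iff det_rmat)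
qed

subsection \<open>The intersection number in the universal cover\<close>

text \<open>A logarithm \<open>\<zeta>\<close> of the complex-linear part is a point of the universal cover of
  \<open>Sp2\<close> up to a contractible factor. The sheets cut out by the lifted hypersurface
  \<open>Re (exp \<zeta>) = 1\<close> are numbered consecutively, and every positive crossing raises the number
  by one.\<close>

definition sheet :: "complex \<Rightarrow> int" where
  "sheet \<zeta> = (if Re (exp \<zeta>) > 1 then 2 * round (Im \<zeta> / (2*pi)) else 2 * \<lfloor>Im \<zeta> / (2*pi)\<rfloor> + 1)"

text \<open>Adding a period of \<open>exp\<close> is a deck transformation; one full turn passes one
  even and one odd sheet, hence the factor 2.\<close>

lemma sheet_shift: "sheet (\<zeta> + 2 * pi * of_int m * \<i>) = sheet \<zeta> + 2 * m"
proof -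
  have "exp (\<zeta> + 2 * pi * of_int m * \<i>) = exp \<zeta>"
    unfolding exp_eq by (rule exI [of _ m]) simp
  moreover have "Im (\<zeta> + 2 * pi * of_int m * \<i>) / (2*pi) = Im \<zeta> / (2*pi) + of_int m"
    by (simp add: field_simps)
  moreover have "round (Im \<zeta> / (2*pi) + of_int m) = round (Im \<zeta> / (2*pi)) + m"
  proof -
    have "Im \<zeta> / (2*pi) + of_int m + 1/2 = (Im \<zeta> / (2*pi) + 1/2) + of_int m" by simp
    then show ?thesis unfolding round_def by (simp only: floor_add_int)
  qed
  ultimately show ?thesis
    unfolding sheet_def by simp
qed

text \<open>Rounding errs by at most 1/2, which doubling turns into 1; the odd value is the midpoint
  of an interval of length 2 that contains \<open>Im \<zeta> / pi\<close>. This bound later ties the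
  integer count to the argument.\<close>

lemma sheet_bound: "\<bar>real_of_int (sheet \<zeta>) - Im \<zeta> / pi\<bar> \<le> 1"
proof -
  define x where "x = Im \<zeta> / (2*pi)"
  have x: "Im \<zeta> / pi = 2 * x" by (simp add: x_def)
  have "\<bar>real_of_int (round x) - x\<bar> \<le> 1/2" by (rule of_int_round_abs_le)
  moreover have "2 * x - 2 * of_int \<lfloor>x\<rfloor> \<le> 2" "2 * of_int \<lfloor>x\<rfloor> \<le> 2 * x" by linarith+
  ultimately show ?thesis
    unfolding sheet_def x x_def [symmetric] abs_le_iff by auto
qed

section \<open>Local behaviour of the sheet number\<close>

lemma round_div_2pi_eq:
  assumes "\<bar>y - 2*pi * of_int k\<bar> < pi/2"
  shows "round (y / (2*pi)) = k"
proof (rule round_unique')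
  have *: "y / (2*pi) - of_int k = (y - 2*pi * of_int k) / (2*pi)" by (simp add: field_simps)
  show "\<bar>y / (2*pi) - of_int k\<bar> < 1/2"
  proof -
    have "\<bar>y - 2*pi * of_int k\<bar> < pi" using assms pi_gt_zero by linarith
    then show ?thesis unfolding * by (simp add: abs_divide)
  qed
qed

lemma floor_div_2pi_eq:
  assumes "2*pi * of_int k \<le> y" "y < 2*pi * of_int k + 2*pi"
  shows "\<lfloor>y / (2*pi)\<rfloor> = k"
  using assms by (intro floor_unique) (auto simp: field_simps)

lemma near_multiple_of_2pi:
  assumes "cos y > 0"
  obtains k :: int where "\<bar>y - 2*pi * of_int k\<bar> < pi/2" "sin y = sin (y - 2*pi * of_int k)"
proof -
  define k where "k = round (y / (2*pi))"
  define x where "x = y - 2*pi * of_int k"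
  have c: "cos x = cos y"
    by (simp add: x_def cos_diff)
  have "\<bar>of_int k - y / (2*pi)\<bar> \<le> 1/2"
    unfolding k_def by (rule of_int_round_abs_le)
  then have "\<bar>x\<bar> \<le> pi"
    by (simp add: x_def abs_if field_simps split: if_splits)
  moreover have "cos \<bar>x\<bar> > 0" using assms c by simp
  ultimately have "\<bar>x\<bar> < pi/2"
    using cos_monotone_0_pi_le [of "pi/2" "\<bar>x\<bar>"] by (cases "pi/2 \<le> \<bar>x\<bar>") auto
  moreover have "sin y = sin x"
    by (simp add: x_def sin_diff)
  ultimately show ?thesis
    using that [of k] x_def by metis
qed

text \<open>Stated at \<open>nhds\<close> and not at the punctured filter, because the sheet lemmas
  are composed with a lifted path that may return to its value at the limit time.\<close>

lemma tendsto_nhds_Re_exp: "((\<lambda>\<xi>. Re (exp \<xi>)) \<longlongrightarrow> Re (exp \<zeta>)) (nhds \<zeta>)"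
  and tendsto_nhds_Im: "((\<lambda>\<xi>. Im \<xi>) \<longlongrightarrow> Im \<zeta>) (nhds \<zeta>)"
proof -
  have "((\<lambda>\<xi>. \<xi>) \<longlongrightarrow> \<zeta>) (nhds \<zeta>)" by (rule filterlim_ident)
  then show "((\<lambda>\<xi>. Re (exp \<xi>)) \<longlongrightarrow> Re (exp \<zeta>)) (nhds \<zeta>)"
    "((\<lambda>\<xi>. Im \<xi>) \<longlongrightarrow> Im \<zeta>) (nhds \<zeta>)"
    by (auto intro: tendsto_intros)
qed

text \<open>Where the real part of \<open>exp\<close> exceeds 1, the nearest multiple of
  \<open>2*pi\<close> is locally fixed. Below 1 the floor could jump only over a multiple of
  \<open>2*pi\<close>, where the cosine is 1; then \<open>Re \<zeta> \<ge> 0\<close>, which on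
  \<open>Sp2\<close> says that |a| is at least 1, would give
  \<open>Re (exp \<zeta>) \<ge> 1\<close>.\<close>

lemma sheet_near_regular:
  assumes "Re (exp \<zeta>) > 1 \<or> (Re (exp \<zeta>) < 1 \<and> Re \<zeta> \<ge> 0)"
  shows "eventually (\<lambda>\<xi>. sheet \<xi> = sheet \<zeta>) (nhds \<zeta>)"
  using assms
proof
  assume gt: "Re (exp \<zeta>) > 1"
  then have "cos (Im \<zeta>) > 0"
    by (metis Re_exp exp_gt_zero less_numeral_extra(1) order_less_trans zero_less_mult_pos)
  then obtain k :: int where k: "\<bar>Im \<zeta> - 2*pi * of_int k\<bar> < pi/2"
    using near_multiple_of_2pi by metis
  have "eventually (\<lambda>\<xi>. Re (exp \<xi>) > 1) (nhds \<zeta>)"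
    using gt by (intro order_tendstoD(1) [OF tendsto_nhds_Re_exp]) simp_all
  moreover have "eventually (\<lambda>\<xi>. \<bar>Im \<xi> - 2*pi * of_int k\<bar> < pi/2) (nhds \<zeta>)"
    using k by (intro order_tendstoD(2) [OF tendsto_rabs [OF tendsto_diff [OF tendsto_nhds_Im tendsto_const]]]) simp_all
  ultimately show ?thesis
  proof eventually_elim
    case (elim \<xi>)
    have "round (Im \<xi> / (2*pi)) = k" "round (Im \<zeta> / (2*pi)) = k"
      using elim k pi_gt_zero by (auto intro!: round_div_2pi_eq)
    then show ?case using elim gt by (simp add: sheet_def)
  qed
next
  assume lt: "Re (exp \<zeta>) < 1 \<and> Re \<zeta> \<ge> 0"
  define k where "k = \<lfloor>Im \<zeta> / (2*pi)\<rfloor>"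
  have "2*pi * of_int k \<noteq> Im \<zeta>"
  proof
    assume *: "2*pi * of_int k = Im \<zeta>"
    have "cos (Im \<zeta>) = 1" unfolding * [symmetric] by (simp add: cos_int_2pin)
    then show False using lt by (auto simp: Re_exp)
  qed
  moreover have "of_int k \<le> Im \<zeta> / (2*pi)" "Im \<zeta> / (2*pi) < of_int k + 1"
    unfolding k_def by linarith+
  ultimately have k: "2*pi * of_int k < Im \<zeta>" "Im \<zeta> < 2*pi * of_int k + 2*pi"
    by (auto simp: field_simps)
  have "eventually (\<lambda>\<xi>. Re (exp \<xi>) < 1) (nhds \<zeta>)"
    using lt by (intro order_tendstoD(2) [OF tendsto_nhds_Re_exp]) simp_all
  moreover have "eventually (\<lambda>\<xi>. 2*pi * of_int k < Im \<xi>) (nhds \<zeta>)"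
    using k by (intro order_tendstoD(1) [OF tendsto_nhds_Im]) simp_all
  moreover have "eventually (\<lambda>\<xi>. Im \<xi> < 2*pi * of_int k + 2*pi) (nhds \<zeta>)"
    using k by (intro order_tendstoD(2) [OF tendsto_nhds_Im]) simp_all
  ultimately show ?thesis
  proof eventually_elim
    case (elim \<xi>)
    have "\<lfloor>Im \<xi> / (2*pi)\<rfloor> = k" using elim by (intro floor_div_2pi_eq) auto
    then show ?case using elim lt by (simp add: sheet_def k_def)
  qed
qed

text \<open>A regular point of the lifted hypersurface has an argument within \<open>pi/2\<close> of
  some \<open>2*pi*k\<close>, but different from it. The side with real part above 1 is the even
  sheet \<open>2*k\<close>; the other side is \<open>2*k + 1\<close> for arguments above
  \<open>2*pi*k\<close> and \<open>2*k - 1\<close> below, so the sign of the imaginary part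
  decides.\<close>

lemma sheet_near_crossing:
  assumes "Re (exp \<zeta>) = 1" "Im (exp \<zeta>) \<noteq> 0"
  obtains m n :: int where
    "eventually (\<lambda>\<xi>. sheet \<xi> = (if Re (exp \<xi>) > 1 then m else n)) (nhds \<zeta>)"
    "real_of_int (n - m) = sgn (Im (exp \<zeta>))"
proof -
  have "cos (Im \<zeta>) > 0"
    using assms by (metis Re_exp exp_gt_zero less_numeral_extra(1) zero_less_mult_pos)
  then obtain k :: int where k: "\<bar>Im \<zeta> - 2*pi * of_int k\<bar> < pi/2"
    and s: "sin (Im \<zeta>) = sin (Im \<zeta> - 2*pi * of_int k)"
    using near_multiple_of_2pi by metis
  have sg: "sgn (Im (exp \<zeta>)) = sgn (sin (Im \<zeta> - 2*pi * of_int k))"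
    by (simp add: Im_exp sgn_mult s)
  define x where "x = Im \<zeta> - 2*pi * of_int k"
  have xb: "\<bar>x\<bar> < pi/2" and sx: "sgn (Im (exp \<zeta>)) = sgn (sin x)"
    using k sg by (simp_all add: x_def)
  have x0: "x \<noteq> 0" using assms sx by (auto simp: sgn_zero_iff)
  have e1: "eventually (\<lambda>\<xi>. \<bar>Im \<xi> - 2*pi * of_int k\<bar> < pi/2) (nhds \<zeta>)"
    using k by (intro order_tendstoD(2) [OF tendsto_rabs [OF tendsto_diff [OF tendsto_nhds_Im tendsto_const]]]) simp_all
  show ?thesis
  proof (cases "x > 0")
    case True
    then have "sin x > 0" using xb by (intro sin_gt_zero) auto
    then have sg1: "sgn (Im (exp \<zeta>)) = 1" using sx by simp
    have "eventually (\<lambda>\<xi>. Im \<xi> > 2*pi * of_int k) (nhds \<zeta>)"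
      using True x_def by (intro order_tendstoD(1) [OF tendsto_nhds_Im]) simp_all
    with e1 have "eventually (\<lambda>\<xi>. sheet \<xi> = (if Re (exp \<xi>) > 1 then 2*k else 2*k + 1)) (nhds \<zeta>)"
    proof eventually_elim
      case (elim \<xi>)
      have "round (Im \<xi> / (2*pi)) = k" "\<lfloor>Im \<xi> / (2*pi)\<rfloor> = k"
        using elim pi_gt_zero by (auto intro!: round_div_2pi_eq floor_div_2pi_eq)
      then show ?case by (simp add: sheet_def)
    qed
    then show ?thesis using that [of "2*k" "2*k + 1"] sg1 by simp 
  next
    case False
    then have "sin (-x) > 0" using xb x0 by (intro sin_gt_zero) auto
    then have sg1: "sgn (Im (exp \<zeta>)) = -1" using sx by simp
    have "eventually (\<lambda>\<xi>. Im \<xi> < 2*pi * of_int k) (nhds \<zeta>)"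
      using False x0 x_def by (intro order_tendstoD(2) [OF tendsto_nhds_Im]) simp_all
    with e1 have "eventually (\<lambda>\<xi>. sheet \<xi> = (if Re (exp \<xi>) > 1 then 2*k else 2*k - 1)) (nhds \<zeta>)"
    proof eventually_elim
      case (elim \<xi>)
      have "round (Im \<xi> / (2*pi)) = k" "\<lfloor>Im \<xi> / (2*pi)\<rfloor> = k - 1"
        using elim pi_gt_zero by (auto intro!: round_div_2pi_eq floor_div_2pi_eq simp: right_diff_distrib abs_less_iff)
      then show ?case by (simp add: sheet_def)
    qed
    then show ?thesis using that [of "2*k" "2*k - 1"] sg1 by simp
  qed
qed

section \<open>Counting crossings by the jumps of the sheet number\<close>

lemma sum_jumps:
  fixes f d :: "real \<Rightarrow> real"
  assumes C: "finite C" "C \<subseteq> {0<..<1}"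
    and reg: "\<And>t. t \<in> {0..1} - C \<Longrightarrow> eventually (\<lambda>s. f s = f t) (at t within {0..1})"
    and jump: "\<And>c. c \<in> C \<Longrightarrow> \<exists>l. eventually (\<lambda>s. f s = l) (at_left c) \<and>
                 eventually (\<lambda>s. f s = l + d c) (at_right c)"
  shows "f 1 - f 0 = sum d C"
proof -
  obtain l where l: "\<And>c. c \<in> C \<Longrightarrow> eventually (\<lambda>s. f s = l c) (at_left c)"
      "\<And>c. c \<in> C \<Longrightarrow> eventually (\<lambda>s. f s = l c + d c) (at_right c)"
    using jump by metis
  \<comment> \<open>Removing the jumps already passed, and replacing the arbitrary value at a jump
    by the left limit, makes the function locally constant; connectedness of the interval then gives
    \<open>g 0 = g 1\<close>.\<close>
  define g where "g t = (if t \<in> C then l t else f t) - sum d {c \<in> C. c < t}" for t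
  have loc: "eventually (\<lambda>s. g t = g s) (at t within {0..1})" if t: "t \<in> {0..1}" for t
  proof -
    have "eventually (\<lambda>s. \<forall>c\<in>C - {t}. s \<noteq> c \<and> (c < s \<longleftrightarrow> c < t)) (at t)"
    proof (intro eventually_ball_finite ballI)
      fix c assume c: "c \<in> C - {t}"
      show "eventually (\<lambda>s. s \<noteq> c \<and> (c < s \<longleftrightarrow> c < t)) (at t)"
      proof (cases "c < t")
        case True
        have "eventually (\<lambda>s. s > c) (at t)"
          using True by (intro order_tendstoD(1) [OF tendsto_ident_at])
        then show ?thesis by eventually_elim (use True in auto)
      next
        case False
        with c have "t < c" by auto
        then have "eventually (\<lambda>s. s < c) (at t)"
          by (intro order_tendstoD(2) [OF tendsto_ident_at])
        then show ?thesis by eventually_elim (use \<open>t < c\<close> in auto)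
      qed
    qed (use C in auto)
    then have near: "eventually (\<lambda>s. s \<noteq> t \<and> (\<forall>c\<in>C - {t}. s \<noteq> c \<and> (c < s \<longleftrightarrow> c < t))) (at t)"
      by (intro eventually_conj eventually_neq_at_within)
    show ?thesis
    proof (cases "t \<in> C")
      case False
      have "eventually (\<lambda>s. s \<noteq> t \<and> (\<forall>c\<in>C - {t}. s \<noteq> c \<and> (c < s \<longleftrightarrow> c < t))) (at t within {0..1})"
        using near by (rule filter_leD [OF at_le, rotated]) auto
      moreover have "eventually (\<lambda>s. f s = f t) (at t within {0..1})"
        using reg t False by blast
      ultimately show ?thesis
      proof eventually_elim
        case (elim s)
        have "{c \<in> C. c < s} = {c \<in> C. c < t}" "s \<notin> C" using elim False by auto
        then show ?case using False elim by (simp add: g_def)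
      qed
    next
      case True
      have less: "eventually (\<lambda>s. s < t) (at_left t)" by (simp add: eventually_at_filter)
      have L: "eventually (\<lambda>s. g t = g s) (at_left t)"
        using l(1) [OF True] filter_leD [OF at_le [OF subset_UNIV] near]
          less
      proof eventually_elim
        case (elim s)
        then have *: "s < t" "s \<notin> C" "\<And>c. c \<in> C \<Longrightarrow> c \<noteq> t \<Longrightarrow> c < s \<longleftrightarrow> c < t" by auto
        have "{c \<in> C. c < s} = {c \<in> C. c < t}"
          using * by (metis (lifting) not_less_iff_gr_or_eq order_less_trans)
        then show ?case using True elim * by (simp add: g_def)
      qed
      have R: "eventually (\<lambda>s. g t = g s) (at_right t)"
        using l(2) [OF True] filter_leD [OF at_le [OF subset_UNIV] near]
          eventually_at_right_less [of t]
      proof eventually_elim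
        case (elim s)
        then have *: "t < s" "s \<notin> C" "\<And>c. c \<in> C \<Longrightarrow> c \<noteq> t \<Longrightarrow> c < s \<longleftrightarrow> c < t" by auto
        have "{c \<in> C. c < s} = insert t {c \<in> C. c < t}"
          using * True by auto
        moreover have "finite {c \<in> C. c < t}" using C by simp
        ultimately show ?case using True elim * by (simp add: g_def)
      qed
      have "eventually (\<lambda>s. g t = g s) (at t)"
        using L R by (simp add: eventually_at_split)
      then show ?thesis
        by (rule filter_leD [OF at_le, rotated]) auto
    qed
  qed
  have "g 0 = g 1"
    by (rule connected_local_const [of "{0..1}"]) (use loc in auto)
  moreover have "{c \<in> C. c < 0} = {}" "{c \<in> C. c < 1} = C" "0 \<notin> C" "1 \<notin> C"
    using C by force+
  ultimately show ?thesis by (simp add: g_def)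
qed

text \<open>On \<open>Sp2\<close> the defining function is 2 - 2 Re a. If Re a has derivative r
  along the path, the two derivatives in \<open>crossing_sign\<close> are -2 r and 2 Im a, so the
  sign is - sgn r * sgn (Im a). By \<open>sheet_near_crossing\<close> this is exactly the jump of
  the sheet number when Re a passes 1 in the direction of r.\<close>

lemma crossing_sum:
  assumes C1: "\<beta> C1_differentiable_on {0..1}"
    and Sp: "\<And>t. t \<in> {0..1} \<Longrightarrow> \<beta> t \<in> Sp2"
    and fin: "finite (crossing_times \<beta>)"
    and trans: "\<And>t. t \<in> crossing_times \<beta> \<Longrightarrow> transverse_crossing \<beta> t"
    and ends: "\<beta> 0 \<notin> Sp2_01" "\<beta> 1 \<notin> Sp2_01"
    and q: "continuous_on {0..1} q" "\<And>t. t \<in> {0..1} \<Longrightarrow> clin (\<beta> t) = exp (q t)"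
  shows "(\<Sum>t\<in>crossing_times \<beta>. crossing_sign \<beta> t) = real_of_int (sheet (q 1) - sheet (q 0))"
proof -
  have q_lim: "filterlim q (nhds (q t)) (at t within {0..1})" if "t \<in> {0..1}" for t
    using q(1) that by (simp add: continuous_on)
  have q_Re: "Re (q t) \<ge> 0" if "t \<in> {0..1}" for t
    using Sp2_norm_clin_ge_1 [OF Sp [OF that]] q(2) [OF that] by simp
  have sub: "crossing_times \<beta> \<subseteq> {0<..<1}"
    using ends by (force simp: crossing_times_def less_le)
  have "real_of_int (sheet (q 1)) - real_of_int (sheet (q 0)) = sum (crossing_sign \<beta>) (crossing_times \<beta>)"
  proof (rule sum_jumps [OF fin sub])
    fix t assume t: "t \<in> {0..1} - crossing_times \<beta>"
    then have "Re (exp (q t)) \<noteq> 1"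
      using Sp q(2) by (auto simp: crossing_times_def mem_Sp2_01_iff)
    then have "eventually (\<lambda>\<xi>. sheet \<xi> = sheet (q t)) (nhds (q t))"
      using t q_Re [of t] by (intro sheet_near_regular) auto
    then show "eventually (\<lambda>s. real_of_int (sheet (q s)) = real_of_int (sheet (q t))) (at t within {0..1})"
      using eventually_compose_filterlim [OF _ q_lim [of t]] t by simp
  next
    fix c assume c: "c \<in> crossing_times \<beta>"
    then have c01: "0 < c" "c < 1" and Rec: "Re (clin (\<beta> c)) = 1"
      using sub by (auto simp: crossing_times_def mem_Sp2_01_iff)
    define a where "a = (\<lambda>s. clin (\<beta> s))"
    have qc: "exp (q c) = a c" using q(2) [of c] c01 by (simp add: a_def)
    have at_c: "at c within {0..1} = at c"
      using c01 by (intro at_within_interior) auto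
    have inside: "eventually (\<lambda>s. s \<in> {0<..<1}) (at c)"
      using c01 by (intro eventually_at_in_open' ) auto
    obtain D where D: "(\<beta> has_vector_derivative D) (at c)"
      using C1 c01 unfolding C1_differentiable_on_def by force
    have a_deriv: "(a has_vector_derivative clin D) (at c)"
      unfolding a_def by (rule bounded_linear.has_vector_derivative [OF bounded_linear_clin D])
    define r where "r = Re (clin D)"
    have Re_deriv: "((\<lambda>s. Re (a s)) has_real_derivative r) (at c)"
      unfolding r_def has_real_derivative_iff_has_vector_derivative
      by (rule bounded_linear.has_vector_derivative [OF bounded_linear_Re a_deriv])
    have Im_deriv: "((\<lambda>s. Im (a s)) has_real_derivative Im (clin D)) (at c)"
      unfolding has_real_derivative_iff_has_vector_derivative
      by (rule bounded_linear.has_vector_derivative [OF bounded_linear_Im a_deriv])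
    have "((\<lambda>s. 2 - 2 * Re (a s)) has_real_derivative 0 - 2 * r) (at c)"
      by (intro DERIV_diff DERIV_const DERIV_cmult Re_deriv)
    then have "((\<lambda>s. det (\<beta> s - mat 1)) has_real_derivative 0 - 2 * r) (at c)"
      by (rule has_field_derivative_transform_within_open [where S = "{0<..<1}"])
        (use c01 Sp det_minus_mat_1_Sp2 in \<open>auto simp: a_def\<close>)
    then have der1: "deriv (\<lambda>s. det (\<beta> s - mat 1)) c = - 2 * r"
      by (simp add: DERIV_imp_deriv)
    have "det (\<beta> c ** expJ s - mat 1) = 2 - 2 * (Re (a c) * cos s - Im (a c) * sin s)" for s
      using det_minus_mat_1_Sp2 [OF Sp2_mult [OF Sp expJ_in_Sp2], of c s] c01
      by (simp add: clin_mult a_def)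
    moreover have "((\<lambda>s. 2 - 2 * (Re (a c) * cos s - Im (a c) * sin s)) has_real_derivative 2 * Im (a c)) (at 0)"
      by (auto intro!: derivative_eq_intros)
    ultimately have der2: "deriv (\<lambda>s. det (\<beta> c ** expJ s - mat 1)) 0 = 2 * Im (a c)"
      by (simp add: DERIV_imp_deriv)
    have r0: "r \<noteq> 0"
      using trans [OF c] by (simp add: transverse_crossing_def der1)
    have Im0: "Im (a c) \<noteq> 0"
    proof
      assume 0: "Im (a c) = 0"
      \<comment> \<open>\<open>\<bar>a\<bar>\<close> is at least 1 on \<open>Sp2\<close>, so it has a minimum where \<open>a = 1\<close>.\<close>
      have "((\<lambda>s. (Re (a s))\<^sup>2 + (Im (a s))\<^sup>2) has_real_derivative 2 * r) (at c)"
        using DERIV_add [OF DERIV_power [OF Re_deriv, of 2] DERIV_power [OF Im_deriv, of 2]] 0 Rec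
        by (simp add: a_def)
      moreover have "(Re (a c))\<^sup>2 + (Im (a c))\<^sup>2 \<le> (Re (a s))\<^sup>2 + (Im (a s))\<^sup>2" if "\<bar>c - s\<bar> < min c (1 - c)" for s
      proof -
        have "s \<in> {0..1}" using that by auto
        then have "norm (a s) \<ge> 1" unfolding a_def by (intro Sp2_norm_clin_ge_1 Sp)
        then have "(norm (a s))\<^sup>2 \<ge> 1" by simp
        then show ?thesis using 0 Rec by (simp add: cmod_power2 a_def)
      qed
      ultimately have "2 * r = 0"
        using c01 by (intro DERIV_local_min [where d = "min c (1 - c)"]) auto
      then show False using r0 by simp
    qed
    have sign: "crossing_sign \<beta> c = - sgn r * sgn (Im (a c))"
      by (simp add: crossing_sign_def der1 der2 sgn_mult)
    obtain m n :: int where mn: "eventually (\<lambda>\<xi>. sheet \<xi> = (if Re (exp \<xi>) > 1 then m else n)) (nhds (q c))"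
      "real_of_int (n - m) = sgn (Im (exp (q c)))"
      using sheet_near_crossing [of "q c"] Rec Im0 qc by (auto simp: a_def)
    have "eventually (\<lambda>s. sheet (q s) = (if Re (exp (q s)) > 1 then m else n)) (at c)"
      using eventually_compose_filterlim [OF mn(1) q_lim [of c]] c01 by (simp add: at_c)
    with inside have ev: "eventually (\<lambda>s. sheet (q s) = (if Re (a s) > 1 then m else n)) (at c)"
      by eventually_elim (use q(2) in \<open>auto simp: a_def\<close>)
    note evL = ev [unfolded eventually_at_split, THEN conjunct1]
    note evR = ev [unfolded eventually_at_split, THEN conjunct2]
    have nm: "real_of_int n = real_of_int m + sgn (Im (a c))" using mn(2) by (simp add: qc)
    have Rc: "Re (a c) = 1" using Rec by (simp add: a_def)
    show "\<exists>l. eventually (\<lambda>s. real_of_int (sheet (q s)) = l) (at_left c) \<and>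
        eventually (\<lambda>s. real_of_int (sheet (q s)) = l + crossing_sign \<beta> c) (at_right c)"
    proof (cases "r > 0")
      case True
      obtain d where d: "d > 0" "\<And>h. 0 < h \<Longrightarrow> h < d \<Longrightarrow> Re (a c) < Re (a (c + h))"
        using DERIV_pos_inc_right [OF Re_deriv True] by blast
      obtain e where e: "e > 0" "\<And>h. 0 < h \<Longrightarrow> h < e \<Longrightarrow> Re (a (c - h)) < Re (a c)"
        using DERIV_pos_inc_left [OF Re_deriv True] by blast
      have "eventually (\<lambda>s. s \<in> {c - e<..<c}) (at_left c)" "eventually (\<lambda>s. s \<in> {c<..<c + d}) (at_right c)"
        using d(1) e(1) by (intro eventually_at_left_real eventually_at_right_real; simp)+
      then have "eventually (\<lambda>s. Re (a s) < 1) (at_left c)" "eventually (\<lambda>s. Re (a s) > 1) (at_right c)"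
        using d(2) [of "_ - c"] e(2) [of "c - _"] by (auto elim!: eventually_mono simp: Rc)
      then have "eventually (\<lambda>s. real_of_int (sheet (q s)) = n) (at_left c)"
        "eventually (\<lambda>s. real_of_int (sheet (q s)) = m) (at_right c)"
        using evL evR by (auto elim: eventually_elim2)
      moreover have "real_of_int m = real_of_int n + crossing_sign \<beta> c" using nm sign True by simp
      ultimately show ?thesis by metis
    next
      case False
      with r0 have neg: "r < 0" by simp
      obtain d where d: "d > 0" "\<And>h. 0 < h \<Longrightarrow> h < d \<Longrightarrow> Re (a c) > Re (a (c + h))"
        using DERIV_neg_dec_right [OF Re_deriv neg] by blast
      obtain e where e: "e > 0" "\<And>h. 0 < h \<Longrightarrow> h < e \<Longrightarrow> Re (a (c - h)) > Re (a c)"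
        using DERIV_neg_dec_left [OF Re_deriv neg] by blast
      have "eventually (\<lambda>s. s \<in> {c - e<..<c}) (at_left c)" "eventually (\<lambda>s. s \<in> {c<..<c + d}) (at_right c)"
        using d(1) e(1) by (intro eventually_at_left_real eventually_at_right_real; simp)+
      then have "eventually (\<lambda>s. Re (a s) > 1) (at_left c)" "eventually (\<lambda>s. Re (a s) < 1) (at_right c)"
        using d(2) [of "_ - c"] e(2) [of "c - _"] by (auto elim!: eventually_mono simp: Rc)
      then have "eventually (\<lambda>s. real_of_int (sheet (q s)) = m) (at_left c)"
        "eventually (\<lambda>s. real_of_int (sheet (q s)) = n) (at_right c)"
        using evL evR by (auto elim: eventually_elim2)
      moreover have "real_of_int n = real_of_int m + crossing_sign \<beta> c" using nm sign neg by simp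
      ultimately show ?thesis by metis
    qed
  qed
  then show ?thesis by simp
qed

section \<open>Homotopy invariance and uniqueness of the count\<close>

lemma exp_lifts_differ_by_period:
  fixes q q' :: "real \<Rightarrow> complex"
  assumes "continuous_on {0..1} q" "continuous_on {0..1} q'"
    and "\<And>t. t \<in> {0..1} \<Longrightarrow> exp (q t) = exp (q' t)"
  obtains m :: int where "\<And>t. t \<in> {0..1} \<Longrightarrow> q t = q' t + 2 * pi * of_int m * \<i>"
proof -
  have int: "\<exists>n::int. q t - q' t = 2 * pi * of_int n * \<i>" if t: "t \<in> {0..1}" for t
  proof -
    obtain n :: int where "q t = q' t + (of_int (2 * n) * pi) * \<i>"
      using assms(3) [OF t] unfolding exp_eq by blast
    then show ?thesis by (intro exI [of _ n]) simp
  qed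
  have "(\<lambda>t. q t - q' t) constant_on {0..1}"
  proof (rule continuous_discrete_range_constant)
    show "continuous_on {0..1} (\<lambda>t. q t - q' t)" using assms by (intro continuous_intros)
    fix t :: real assume t: "t \<in> {0..1}"
    \<comment> \<open>The difference of the lifts takes values in the integer multiples of 2 pi i,
      and distinct ones are at least 2 pi apart; a continuous function with such a range is
      constant.\<close>
    show "\<exists>e>0. \<forall>y. y \<in> {0..1} \<and> q y - q' y \<noteq> q t - q' t \<longrightarrow> e \<le> norm (q y - q' y - (q t - q' t))"
    proof (intro exI [of _ "2*pi"] conjI allI impI)
      fix y :: real assume y: "y \<in> {0..1} \<and> q y - q' y \<noteq> q t - q' t"
      obtain n k :: int where nk: "q y - q' y = 2 * pi * of_int n * \<i>" "q t - q' t = 2 * pi * of_int k * \<i>"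
        using int t y by metis
      have "q y - q' y - (q t - q' t) = complex_of_real (2 * pi * of_int (n - k)) * \<i>"
        unfolding nk by (simp add: algebra_simps)
      then have "norm (q y - q' y - (q t - q' t)) = 2 * pi * \<bar>of_int (n - k)\<bar>"
        by (simp add: norm_mult abs_mult del: of_int_diff)
      moreover have "n \<noteq> k" using y nk by auto
      then have "\<bar>real_of_int (n - k)\<bar> \<ge> 1" by linarith
      then have "2 * pi * 1 \<le> 2 * pi * \<bar>real_of_int (n - k)\<bar>"
        by (intro mult_left_mono) auto
      ultimately show "2 * pi \<le> norm (q y - q' y - (q t - q' t))" by simp
    qed auto
  qed auto
  then obtain c where c: "\<And>t. t \<in> {0..1} \<Longrightarrow> q t - q' t = c" by (auto simp: constant_on_def)
  obtain m :: int where "c = 2 * pi * of_int m * \<i>"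
    using int [of 0] c [of 0] by auto
  then show ?thesis using c that [of m] by (metis add.commute diff_add_cancel)
qed

text \<open>\<open>clin\<close> maps \<open>Sp2\<close> into the punctured plane, where the winding
  number of a path, closed or not, is the displacement of a continuous logarithm and is invariant
  under homotopy with fixed ends. Hence both lifts differ by the same period at the two ends, and
  \<open>sheet_shift\<close> cancels it.\<close>

lemma sheet_diff_homotopic:
  assumes hom: "homotopic_paths Sp2 \<alpha> \<beta>"
    and q: "continuous_on {0..1} q" "\<And>t. t \<in> {0..1} \<Longrightarrow> clin (\<alpha> t) = exp (q t)"
    and q': "continuous_on {0..1} q'" "\<And>t. t \<in> {0..1} \<Longrightarrow> clin (\<beta> t) = exp (q' t)"
  shows "sheet (q 1) - sheet (q 0) = sheet (q' 1) - sheet (q' 0)"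
proof -
  have h0: "homotopic_paths (-{0}) (clin \<circ> \<alpha>) (clin \<circ> \<beta>)"
    by (rule homotopic_paths_continuous_image [OF hom])
      (use Sp2_norm_clin_ge_1 in \<open>force intro!: linear_continuous_on bounded_linear_clin\<close>)+
  have lift: "p 1 - p 0 = 2 * of_real pi * \<i> * winding_number (clin \<circ> \<delta>) 0"
    if p: "continuous_on {0..1} p" "\<And>t. t \<in> {0..1} \<Longrightarrow> clin (\<delta> t) = exp (p t)"
      and \<delta>: "path (clin \<circ> \<delta>)" "0 \<notin> path_image (clin \<circ> \<delta>)" for p \<delta>
  proof -
    obtain p' where p': "path p'" "pathfinish p' - pathstart p' = 2 * of_real pi * \<i> * winding_number (clin \<circ> \<delta>) 0"
      "\<And>t. t \<in> {0..1} \<Longrightarrow> (clin \<circ> \<delta>) t = 0 + exp (p' t)"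
      using winding_number_as_continuous_log [OF \<delta>] by metis
    obtain m :: int where m: "\<And>t. t \<in> {0..1} \<Longrightarrow> p t = p' t + 2 * pi * of_int m * \<i>"
      using exp_lifts_differ_by_period [of p p'] p p' by (auto simp: path_def)
    show ?thesis
      using m [of 0] m [of 1] p'(2) by (simp add: pathstart_def pathfinish_def)
  qed
  have paths: "path (clin \<circ> \<alpha>)" "path (clin \<circ> \<beta>)" "0 \<notin> path_image (clin \<circ> \<alpha>)" "0 \<notin> path_image (clin \<circ> \<beta>)"
    using homotopic_paths_imp_path [OF h0] homotopic_paths_imp_subset [OF h0] by auto
  have eq: "q 1 - q 0 = q' 1 - q' 0"
    using lift [OF q paths(1,3)] lift [OF q' paths(2,4)] winding_number_homotopic_paths [OF h0] by simp
  have "exp (q 0) = exp (q' 0)"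
    using q(2) [of 0] q'(2) [of 0] homotopic_paths_imp_pathstart [OF hom] by (simp add: pathstart_def)
  then obtain m :: int where m: "q 0 = q' 0 + (of_int (2 * m) * pi) * \<i>"
    unfolding exp_eq by blast
  then have m0: "q 0 = q' 0 + 2 * pi * of_int m * \<i>" by simp
  then have m1: "q 1 = q' 1 + 2 * pi * of_int m * \<i>" using eq by (simp add: algebra_simps)
  show ?thesis unfolding m0 m1 sheet_shift by simp
qed

text \<open>The count does not depend on the transverse representative; this is the uniqueness that
  the definite description in \<open>iota\<close> requires.\<close>

lemma intersection_number_eq:
  assumes "has_intersection_number \<alpha> n"
    and q: "continuous_on {0..1} q" "\<And>t. t \<in> {0..1} \<Longrightarrow> clin (\<alpha> t) = exp (q t)"
  shows "n = sheet (q 1) - sheet (q 0)"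
proof -
  obtain \<beta> where hom: "homotopic_paths Sp2 \<alpha> \<beta>" and C1: "\<beta> C1_differentiable_on {0..1}"
    and fin: "finite (crossing_times \<beta>)" and tr: "\<forall>t\<in>crossing_times \<beta>. transverse_crossing \<beta> t"
    and n: "real_of_int n = (\<Sum>t\<in>crossing_times \<beta>. crossing_sign \<beta> t)"
    and ends: "pathstart \<alpha> \<notin> Sp2_01" "pathfinish \<alpha> \<notin> Sp2_01"
    using assms(1) unfolding has_intersection_number_def by blast
  have Sp: "\<And>t. t \<in> {0..1} \<Longrightarrow> \<beta> t \<in> Sp2"
    using homotopic_paths_imp_subset [OF hom] by (auto simp: path_image_def)
  have "continuous_on {0..1} (\<lambda>t. clin (\<beta> t))"
    using homotopic_paths_imp_path [OF hom]
    by (auto simp: path_def intro!: bounded_linear.continuous_on [OF bounded_linear_clin])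
  moreover have "clin (\<beta> t) \<noteq> 0" if "t \<in> {0..1}" for t
    using Sp2_norm_clin_ge_1 [OF Sp [OF that]] by auto
  ultimately obtain q' where q': "continuous_on {0..1} q'" "\<And>t. t \<in> {0..1} \<Longrightarrow> clin (\<beta> t) = exp (q' t)"
    using continuous_logarithm_on_contractible [of "{0..1::real}" "\<lambda>t. clin (\<beta> t)"]
    by (metis convex_imp_contractible convex_real_interval(5))
  have "real_of_int n = real_of_int (sheet (q' 1) - sheet (q' 0))"
    unfolding n using homotopic_paths_imp_pathstart [OF hom] homotopic_paths_imp_pathfinish [OF hom] ends
    by (intro crossing_sum C1 Sp fin q') (use tr in \<open>auto simp: pathstart_def pathfinish_def\<close>)
  then show ?thesis
    using sheet_diff_homotopic [OF hom q q'] by simp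
qed

subsection \<open>Existence of the intersection number\<close>

lemma DERIV_max_0_square: "((\<lambda>x::real. (max 0 x)\<^sup>2) has_real_derivative 2 * max 0 x) (at x)"
proof -
  consider "x < 0" | "x = 0" | "x > 0" by linarith
  then show ?thesis
  proof cases
    case 1
    have "((\<lambda>x::real. 0) has_real_derivative 2 * max 0 x) (at x)" using 1 by simp
    then show ?thesis
      by (rule has_field_derivative_transform_within_open [where S = "{..<0}"]) (use 1 in auto)
  next
    case 2
    have "(\<lambda>h::real. max 0 h) \<midarrow>0\<rightarrow> max 0 0" by (intro tendsto_intros)
    moreover have "max 0 h = (max 0 h)\<^sup>2 / h" for h :: real
      by (simp add: max_def power2_eq_square)
    ultimately show ?thesis using 2 by (simp add: DERIV_def)
  next
    case 3
    have "((\<lambda>x::real. x\<^sup>2) has_real_derivative 2 * max 0 x) (at x)"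
      using 3 by (auto intro!: derivative_eq_intros)
    then show ?thesis
      by (rule has_field_derivative_transform_within_open [where S = "{0<..}"]) (use 3 in auto)
  qed
qed

text \<open>The squares make the two ramps C1, and their supports overlap, so the denominator of the
  quotient u / (u + v) never vanishes. The strictly positive derivative inside the unit interval is
  what makes crossings transverse in the profile built from this step.\<close>

lemma C1_step_exists:
  obtains \<sigma> \<sigma>' :: "real \<Rightarrow> real"
  where "\<And>x. (\<sigma> has_real_derivative \<sigma>' x) (at x)" "continuous_on UNIV \<sigma>'"
    and "\<And>x. x \<le> 0 \<Longrightarrow> \<sigma> x = 0" "\<And>x. x \<ge> 1 \<Longrightarrow> \<sigma> x = 1" "\<And>x. 0 < x \<Longrightarrow> x < 1 \<Longrightarrow> \<sigma>' x > 0"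
    and "\<And>x. 0 \<le> \<sigma> x" "\<And>x. \<sigma> x \<le> 1"
proof
  define u v :: "real \<Rightarrow> real" where "u x = (max 0 x)\<^sup>2" and "v x = (max 0 (1 - x))\<^sup>2" for x
  define u' v' :: "real \<Rightarrow> real" where "u' x = 2 * max 0 x" and "v' x = - 2 * max 0 (1 - x)" for x
  define \<sigma> where "\<sigma> x = u x / (u x + v x)" for x
  define \<sigma>' where "\<sigma>' x = (u' x * v x - u x * v' x) / ((u x + v x) * (u x + v x))" for x
  have u: "(u has_real_derivative u' x) (at x)" for x
    unfolding u_def [abs_def] u'_def by (rule DERIV_max_0_square)
  have v: "(v has_real_derivative v' x) (at x)" for x
  proof -
    have "((\<lambda>x. 1 - x) has_real_derivative -1) (at x)" by (auto intro!: derivative_eq_intros)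
    from DERIV_chain2 [where f = "\<lambda>x. (max 0 x)\<^sup>2", OF DERIV_max_0_square this]
    show ?thesis unfolding v_def [abs_def] v'_def by simp
  qed
  have pos: "u x + v x > 0" for x
  proof (cases "x > 0")
    case True
    then show ?thesis by (simp add: u_def v_def add_pos_nonneg)
  next
    case False
    then show ?thesis by (simp add: u_def v_def add_nonneg_pos)
  qed
  show "(\<sigma> has_real_derivative \<sigma>' x) (at x)" for x
  proof -
    have "(\<sigma> has_real_derivative (u' x * (u x + v x) - u x * (u' x + v' x)) / ((u x + v x) * (u x + v x))) (at x)"
      unfolding \<sigma>_def [abs_def] by (intro DERIV_divide DERIV_add u v) (use pos [of x] in simp)
    then show ?thesis by (simp add: \<sigma>'_def algebra_simps)
  qed
  show "continuous_on UNIV \<sigma>'"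
    unfolding \<sigma>'_def [abs_def]
  proof (intro continuous_on_divide)
    show "\<forall>x\<in>UNIV. (u x + v x) * (u x + v x) \<noteq> 0" using pos by (simp add: less_le)
  qed (auto simp: u_def v_def u'_def v'_def intro!: continuous_intros)
  show "\<sigma> x = 0" if "x \<le> 0" for x using that by (simp add: \<sigma>_def u_def)
  show "\<sigma> x = 1" if "x \<ge> 1" for x using that by (simp add: \<sigma>_def u_def v_def)
  show "\<sigma>' x > 0" if "0 < x" "x < 1" for x
  proof -
    have "u' x * v x > 0" using that by (simp add: u'_def v_def)
    moreover have "u x * v' x < 0" using that by (simp add: u_def v'_def mult_pos_neg)
    ultimately show ?thesis unfolding \<sigma>'_def using pos [of x] by (intro divide_pos_pos) auto
  qed
  show "0 \<le> \<sigma> x" "\<sigma> x \<le> 1" for x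
    using pos [of x] by (auto simp: \<sigma>_def u_def v_def)
qed

text \<open>The profile first raises \<open>\<bar>b\<bar>\<close> to a small value \<open>c\<close>, then rotates with \<open>\<bar>b\<bar> = c\<close>
  fixed, and finally moves \<open>\<bar>b\<bar>\<close> to its end value with the angle fixed. Only the last two
  stages meet the hypersurface, and on them one of the two factors is constant.\<close>

lemma transverse_profile_exists:
  fixes \<phi>0 \<phi>1 d :: real
  assumes c0: "cos \<phi>0 < 1" and d: "d \<ge> 0" and end1: "sqrt (1 + d\<^sup>2) * cos \<phi>1 \<noteq> 1"
  obtains \<phi> \<phi>' r r' :: "real \<Rightarrow> real"
  where "\<And>t. (\<phi> has_real_derivative \<phi>' t) (at t)" "continuous_on UNIV \<phi>'"
    and "\<And>t. (r has_real_derivative r' t) (at t)" "continuous_on UNIV r'"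
    and "\<phi> 0 = \<phi>0" "\<phi> 1 = \<phi>1" "r 0 = 0" "r 1 = d"
    and "\<And>t. t \<in> {0..1} \<Longrightarrow> sqrt (1 + (r t)\<^sup>2) * cos (\<phi> t) = 1 \<Longrightarrow>
      r t * r' t / sqrt (1 + (r t)\<^sup>2) * cos (\<phi> t) - sqrt (1 + (r t)\<^sup>2) * sin (\<phi> t) * \<phi>' t \<noteq> 0"
proof -
  have small: "eventually (\<lambda>c. x < 1 \<longrightarrow> sqrt (1 + c\<^sup>2) * x < 1) (at_right 0)" for x :: real
  proof (cases "x < 1")
    case True
    have "((\<lambda>c. sqrt (1 + c\<^sup>2) * x) \<longlongrightarrow> sqrt (1 + 0\<^sup>2) * x) (at_right 0)"
      by (intro tendsto_intros)
    then have "eventually (\<lambda>c. sqrt (1 + c\<^sup>2) * x < 1) (at_right 0)"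
      using True by (intro order_tendstoD(2)) auto
    then show ?thesis by eventually_elim simp
  qed simp
  \<comment> \<open>The height c is small enough for the first stage to stay below level 1. The
    condition at \<open>\<phi>1\<close> is conditional because the end angle may have cosine 1, in
    which case the end point lies beyond the hypersurface.\<close>
  have "\<exists>c. 0 < c \<and> (cos \<phi>0 < 1 \<longrightarrow> sqrt (1 + c\<^sup>2) * cos \<phi>0 < 1) \<and>
      (cos \<phi>1 < 1 \<longrightarrow> sqrt (1 + c\<^sup>2) * cos \<phi>1 < 1)"
    by (rule eventually_happens' [OF trivial_limit_at_right_real [of 0]])
      (intro eventually_conj small eventually_at_right_less)
  then obtain c where c: "c > 0" "sqrt (1 + c\<^sup>2) * cos \<phi>0 < 1"
    "cos \<phi>1 < 1 \<Longrightarrow> sqrt (1 + c\<^sup>2) * cos \<phi>1 < 1"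
    using c0 by auto
  obtain \<sigma> \<sigma>' :: "real \<Rightarrow> real" where \<sigma>: "\<And>x. (\<sigma> has_real_derivative \<sigma>' x) (at x)" "continuous_on UNIV \<sigma>'"
    "\<And>x. x \<le> 0 \<Longrightarrow> \<sigma> x = 0" "\<And>x. x \<ge> 1 \<Longrightarrow> \<sigma> x = 1" "\<And>x. 0 < x \<Longrightarrow> x < 1 \<Longrightarrow> \<sigma>' x > 0"
    "\<And>x. 0 \<le> \<sigma> x" "\<And>x. \<sigma> x \<le> 1"
    by (rule C1_step_exists) (rule that)
  \<comment> \<open>Since \<open>\<sigma>\<close> is constant outside the unit interval, the
    arguments \<open>3 * t\<close>, \<open>3 * t - 1\<close> and \<open>3 * t - 2\<close> confine
    the three moves to successive thirds.\<close>
  define \<phi> where "\<phi> t = \<phi>0 + (\<phi>1 - \<phi>0) * \<sigma> (3 * t - 1)" for t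
  define \<phi>' where "\<phi>' t = (\<phi>1 - \<phi>0) * (\<sigma>' (3 * t - 1) * 3)" for t
  define r where "r t = c * \<sigma> (3 * t) + (d - c) * \<sigma> (3 * t - 2)" for t
  define r' where "r' t = c * (\<sigma>' (3 * t) * 3) + (d - c) * (\<sigma>' (3 * t - 2) * 3)" for t
  have chain: "((\<lambda>t. \<sigma> (3 * t - k)) has_real_derivative \<sigma>' (3 * t - k) * 3) (at t)" for t k
    by (rule DERIV_chain2 [OF \<sigma>(1)]) (auto intro!: derivative_eq_intros)
  have cont: "continuous_on UNIV (\<lambda>t. \<sigma>' (3 * t - k))" for k
    by (rule continuous_on_compose2 [OF \<sigma>(2)]) (auto intro!: continuous_intros)
  show ?thesis
  proof
    show "(\<phi> has_real_derivative \<phi>' t) (at t)" for t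
      unfolding \<phi>_def [abs_def] \<phi>'_def by (auto intro!: derivative_eq_intros chain)
    show "(r has_real_derivative r' t) (at t)" for t
      unfolding r_def [abs_def] r'_def using chain [of 0 t]
      by (intro DERIV_add DERIV_cmult chain) simp
    show "continuous_on UNIV \<phi>'"
      unfolding \<phi>'_def [abs_def] by (intro continuous_intros cont)
    show "continuous_on UNIV r'"
      unfolding r'_def [abs_def] using cont [of 0] by (intro continuous_intros cont) simp
    show "\<phi> 0 = \<phi>0" "\<phi> 1 = \<phi>1" "r 0 = 0" "r 1 = d"
      using \<sigma>(3,4) by (simp_all add: \<phi>_def r_def)
    fix t :: real
    assume t: "t \<in> {0..1}" and one: "sqrt (1 + (r t)\<^sup>2) * cos (\<phi> t) = 1"
    define \<rho> where "\<rho> = sqrt (1 + (r t)\<^sup>2)"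
    have \<rho>: "\<rho> > 0" by (simp add: \<rho>_def add_pos_nonneg)
    have cos_pos: "cos (\<phi> t) > 0"
      using one \<rho> unfolding \<rho>_def [symmetric] by (metis zero_less_mult_pos zero_less_one)
    consider "t \<le> 1/3" | "1/3 < t" "t < 2/3" | "t \<ge> 2/3" by linarith
    then show "r t * r' t / sqrt (1 + (r t)\<^sup>2) * cos (\<phi> t) - sqrt (1 + (r t)\<^sup>2) * sin (\<phi> t) * \<phi>' t \<noteq> 0"
    proof cases
      case 1
      then have \<phi>t: "\<phi> t = \<phi>0" and rt: "r t = c * \<sigma> (3 * t)" using \<sigma>(3) by (simp_all add: \<phi>_def r_def)
      have "0 \<le> r t" "r t \<le> c" using c(1) \<sigma>(6,7) [of "3 * t"] by (simp_all add: rt mult_left_le)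
      then have "sqrt (1 + (r t)\<^sup>2) \<le> sqrt (1 + c\<^sup>2)" by (simp add: power_mono)
      then have "sqrt (1 + (r t)\<^sup>2) * cos \<phi>0 \<le> sqrt (1 + c\<^sup>2) * cos \<phi>0"
        using cos_pos \<phi>t by (intro mult_right_mono) auto
      then show ?thesis using c(2) one \<phi>t by simp
    next
      case 2
      then have rt: "r t = c" using \<sigma>(3,4) by (simp add: r_def)
      have r't: "r' t = 0"
      proof -
        have "(r has_real_derivative 0) (at t)"
          using DERIV_const [of c "at t"]
          by (rule has_field_derivative_transform_within_open [where S = "{1/3<..<2/3}"])
            (use 2 \<sigma>(3,4) in \<open>auto simp: r_def\<close>)
        moreover have "(r has_real_derivative r' t) (at t)"
          unfolding r_def [abs_def] r'_def using chain [of 0 t]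
          by (intro DERIV_add DERIV_cmult chain) simp
        ultimately show ?thesis by (rule DERIV_unique [symmetric])
      qed
      \<comment> \<open>Here c > 0 matters: at level 1 it forces the cosine below 1, so the sine is
        nonzero and the rotation crosses away from the singular point.\<close>
      have "1 < sqrt (1 + c\<^sup>2)" using c(1) by simp
      then have "cos (\<phi> t) < 1"
        using one cos_pos unfolding rt
        by (metis less_eq_real_def linorder_not_less mult.right_neutral mult_less_cancel_left_pos mult_le_cancel_left1 order_less_trans zero_less_one)
      then have "sin (\<phi> t) \<noteq> 0"
        using cos_pos sin_zero_abs_cos_one by fastforce
      moreover have "\<phi>1 \<noteq> \<phi>0"
      proof
        assume "\<phi>1 = \<phi>0"
        then show False using one c(2) rt by (simp add: \<phi>_def)
      qed
      moreover have "\<sigma>' (3 * t - 1) > 0" using 2 by (intro \<sigma>(5)) auto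
      ultimately have "sin (\<phi> t) * \<phi>' t \<noteq> 0" by (simp add: \<phi>'_def)
      then show ?thesis using r't \<rho> by (simp add: \<rho>_def)
    next
      case 3
      then have \<phi>t: "\<phi> t = \<phi>1" and rt: "r t = c + (d - c) * \<sigma> (3 * t - 2)"
        using \<sigma>(4) by (simp_all add: \<phi>_def r_def)
      define w where "w = \<sigma> (3 * t - 2)"
      have w: "0 \<le> w" "w \<le> 1" using \<sigma>(6,7) by (simp_all add: w_def)
      have rw: "r t = (1 - w) * c + w * d" by (simp add: rt w_def algebra_simps)
      have r0: "r t \<ge> 0" using w c(1) d by (simp add: rw)
      \<comment> \<open>With cosine 1, level 1 means \<open>r t = 0\<close>; between c > 0 and
        \<open>d\<close> this leaves only \<open>d = 0\<close>, which puts the end point on the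
        hypersurface.\<close>
      have "cos \<phi>1 \<noteq> 1"
      proof
        assume 1: "cos \<phi>1 = 1"
        then have "(r t)\<^sup>2 = 0" using one \<phi>t by simp
        then have "(1 - w) * c + w * d = 0" by (simp add: rw)
        moreover have "(1 - w) * c \<ge> 0" "w * d \<ge> 0" using w c(1) d by auto
        ultimately have "(1 - w) * c = 0" "w * d = 0" by linarith+
        then have "d = 0" using c(1) by auto
        then show False using end1 1 by simp
      qed
      then have lt: "sqrt (1 + c\<^sup>2) * cos \<phi>1 < 1" using c(3) cos_le_one [of \<phi>1] by linarith
      \<comment> \<open>At height at most c the end angle is still below level 1. A crossing in the
        last stage therefore needs a larger height, so this stage rises and r has a positive
        derivative.\<close>
      have rc: "c < r t"
      proof (rule ccontr)
        assume "\<not> c < r t"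
        then have "sqrt (1 + (r t)\<^sup>2) \<le> sqrt (1 + c\<^sup>2)" using r0 by (simp add: power_mono)
        then have "sqrt (1 + (r t)\<^sup>2) * cos \<phi>1 \<le> sqrt (1 + c\<^sup>2) * cos \<phi>1"
          using cos_pos \<phi>t by (intro mult_right_mono) auto
        then show False using lt one \<phi>t by simp
      qed
      then have pos: "(d - c) * w > 0" by (simp add: rt w_def)
      then have dc: "d > c" using w by (simp add: zero_less_mult_iff)
      \<comment> \<open>The derivative of \<open>\<sigma>\<close> is known to be positive only in
        the open interval, so both ends of the last stage must be excluded.\<close>
      have "t \<noteq> 2/3"
      proof
        assume "t = 2/3"
        then have "w = 0" using \<sigma>(3) [of "3 * t - 2"] by (simp add: w_def)
        then show False using pos by simp
      qed
      moreover have "t \<noteq> 1"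
      proof
        assume "t = 1"
        then have "r t = d" using rt \<sigma>(4) [of "3 * t - 2"] by simp
        then show False using one end1 \<phi>t by simp
      qed
      ultimately have t3: "2/3 < t" "t < 1" using 3 t by auto
      have "((\<lambda>s. c + (d - c) * \<sigma> (3 * s - 2)) has_real_derivative (d - c) * (\<sigma>' (3 * t - 2) * 3)) (at t)"
        by (auto intro!: derivative_eq_intros chain)
      then have "(r has_real_derivative (d - c) * (\<sigma>' (3 * t - 2) * 3)) (at t)"
        by (rule has_field_derivative_transform_within_open [where S = "{1/3<..}"])
          (use t3 \<sigma>(4) in \<open>auto simp: r_def\<close>)
      moreover have "(r has_real_derivative r' t) (at t)"
        unfolding r_def [abs_def] r'_def using chain [of 0 t]
        by (intro DERIV_add DERIV_cmult chain) simp
      ultimately have "r' t = (d - c) * (\<sigma>' (3 * t - 2) * 3)" by (metis DERIV_unique)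
      then have r'pos: "r' t > 0" using dc \<sigma>(5) [of "3 * t - 2"] t3 by simp
      have "(\<phi> has_real_derivative 0) (at t)"
        using DERIV_const [of \<phi>1 "at t"]
        by (rule has_field_derivative_transform_within_open [where S = "{2/3<..}"])
          (use t3 \<sigma>(4) in \<open>auto simp: \<phi>_def\<close>)
      moreover have "(\<phi> has_real_derivative \<phi>' t) (at t)"
        unfolding \<phi>_def [abs_def] \<phi>'_def by (auto intro!: derivative_eq_intros chain)
      ultimately have "\<phi>' t = 0" by (metis DERIV_unique)
      moreover have "r t * r' t / \<rho> * cos (\<phi> t) > 0"
        using r'pos rc c(1) \<rho> cos_pos by (intro mult_pos_pos divide_pos_pos) auto
      ultimately show ?thesis unfolding \<rho>_def by (metis diff_zero less_irrefl mult_zero_right)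
    qed
  qed
qed

text \<open>An infinite level set in a compact interval accumulates at one of its points; there the
  difference quotient vanishes arbitrarily close by, which contradicts its nonzero limit.\<close>

lemma finite_regular_level:
  fixes f f' :: "real \<Rightarrow> real"
  assumes der: "\<And>t. t \<in> {0..1} \<Longrightarrow> (f has_real_derivative f' t) (at t)"
    and reg: "\<And>t. t \<in> {0..1} \<Longrightarrow> f t = y \<Longrightarrow> f' t \<noteq> 0"
  shows "finite {t \<in> {0..1}. f t = y}"
proof (rule ccontr)
  define T where "T = {t \<in> {0..1}. f t = y}"
  assume "infinite {t \<in> {0..1}. f t = y}"
  then obtain x where x: "x \<in> {0..1}" "x islimpt T"
    using compact_eq_Bolzano_Weierstrass [of "{0..1::real}"] unfolding T_def
    by (metis (no_types, lifting) compact_Icc mem_Collect_eq subsetI)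
  have "continuous_on {0..1} f"
    using der by (meson DERIV_isCont continuous_at_imp_continuous_on)
  then have "closed T"
    unfolding T_def by (intro continuous_closed_preimage_constant) auto
  then have "x \<in> T" using x closed_limpt by blast
  then have fx: "f x = y" by (simp add: T_def)
  have "((\<lambda>s. (f s - f x) / (s - x)) \<longlongrightarrow> f' x) (at x)"
    using der [OF x(1)] by (simp add: has_field_derivative_iff)
  then have "eventually (\<lambda>s. (f s - f x) / (s - x) \<noteq> 0) (at x)"
    using reg [OF x(1) fx] by (rule tendsto_imp_eventually_ne)
  then have "eventually (\<lambda>s. s \<notin> T) (at x)"
    by eventually_elim (auto simp: T_def fx)
  then show False using x(2) by (simp add: islimpt_conv_frequently_at frequently_def)
qed

text \<open>This is the universal covering map of \<open>Sp2\<close>: |a| is determined by b, so the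
  free coordinates are a real argument of a and b itself. Its domain is a vector space, so
  straight-line homotopies are available.\<close>

definition Sp2_chart :: "real \<times> complex \<Rightarrow> real^2^2" where
  "Sp2_chart = (\<lambda>(\<phi>, b). rmat (of_real (sqrt (1 + (norm b)\<^sup>2)) * cis \<phi>) b)"

lemma continuous_on_rmat [continuous_intros]:
  "continuous_on S f \<Longrightarrow> continuous_on S g \<Longrightarrow> continuous_on S (\<lambda>x. rmat (f x) (g x))"
  using bounded_linear.continuous_on [OF bounded_linear_rmat, of S "\<lambda>x. (f x, g x)"]
  by (simp add: continuous_on_Pair)

lemma continuous_on_Sp2_chart: "continuous_on UNIV Sp2_chart"
  unfolding Sp2_chart_def case_prod_unfold by (intro continuous_intros)

lemma Sp2_chart_in_Sp2: "Sp2_chart x \<in> Sp2"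
  by (simp add: Sp2_chart_def case_prod_unfold mem_Sp2_iff norm_mult)

lemma Sp2_chart_lift:
  assumes "M \<in> Sp2" "clin M = exp \<zeta>"
  shows "M = Sp2_chart (Im \<zeta>, alin M)"
proof -
  have "sqrt (1 + (norm (alin M))\<^sup>2) = norm (clin M)"
    using assms(1) by (simp add: mem_Sp2_iff real_sqrt_unique)
  moreover have "clin M = of_real (norm (clin M)) * cis (Im \<zeta>)"
    unfolding assms(2) norm_exp_eq_Re by (rule exp_eq_polar)
  ultimately show ?thesis by (simp add: Sp2_chart_def)
qed

text \<open>The lifted path is deformed in the covering coordinates to one that follows the
  transverse profile and has the same lifted end points. The profile starts at b = 0, which suits
  the application: the perturbed path starts at the rotation
  \<open>expJ (- \<epsilon>)\<close>.\<close>

lemma intersection_number_exists: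
  assumes \<alpha>: "path \<alpha>" "path_image \<alpha> \<subseteq> Sp2" "alin (\<alpha> 0) = 0"
    and ends: "\<alpha> 0 \<notin> Sp2_01" "\<alpha> 1 \<notin> Sp2_01"
    and q: "continuous_on {0..1} q" "\<And>t. t \<in> {0..1} \<Longrightarrow> clin (\<alpha> t) = exp (q t)"
  shows "has_intersection_number \<alpha> (sheet (q 1) - sheet (q 0))"
proof -
  have Sp: "\<alpha> t \<in> Sp2" if "t \<in> {0..1}" for t using \<alpha>(2) that by (auto simp: path_image_def)
  have \<alpha>_chart: "\<alpha> t = Sp2_chart (Im (q t), alin (\<alpha> t))" if "t \<in> {0..1}" for t
    by (intro Sp2_chart_lift Sp q that)
  have Re_chart: "Re (clin (Sp2_chart (\<phi>, b))) = sqrt (1 + (norm b)\<^sup>2) * cos \<phi>" for \<phi> b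
    by (simp add: Sp2_chart_def)
  define d where "d = norm (alin (\<alpha> 1))"
  \<comment> \<open>A fixed unit direction for b; the default 1 keeps its norm equal to 1 when b
    vanishes at the end.\<close>
  define e where "e = (if d = 0 then 1 else sgn (alin (\<alpha> 1)))"
  have e: "norm e = 1" "alin (\<alpha> 1) = of_real d * e"
    by (auto simp: e_def d_def sgn_eq norm_divide)
  have c0: "cos (Im (q 0)) < 1"
    using ends(1) Sp [of 0] Re_chart [of "Im (q 0)" 0] \<alpha>_chart [of 0] \<alpha>(3) cos_le_one [of "Im (q 0)"]
    by (auto simp: mem_Sp2_01_iff less_le)
  have c1: "sqrt (1 + d\<^sup>2) * cos (Im (q 1)) \<noteq> 1"
    using ends(2) Sp [of 1] Re_chart [of "Im (q 1)" "alin (\<alpha> 1)"] \<alpha>_chart [of 1]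
    by (auto simp: mem_Sp2_01_iff d_def)
  obtain \<phi> \<phi>' r r' :: "real \<Rightarrow> real" where
    \<phi>: "\<And>t. (\<phi> has_real_derivative \<phi>' t) (at t)" "continuous_on UNIV \<phi>'"
    and r: "\<And>t. (r has_real_derivative r' t) (at t)" "continuous_on UNIV r'"
    and bd: "\<phi> 0 = Im (q 0)" "\<phi> 1 = Im (q 1)" "r 0 = 0" "r 1 = d"
    and tr: "\<And>t. t \<in> {0..1} \<Longrightarrow> sqrt (1 + (r t)\<^sup>2) * cos (\<phi> t) = 1 \<Longrightarrow>
      r t * r' t / sqrt (1 + (r t)\<^sup>2) * cos (\<phi> t) - sqrt (1 + (r t)\<^sup>2) * sin (\<phi> t) * \<phi>' t \<noteq> 0"
    using transverse_profile_exists [OF c0 _ c1] by (metis d_def norm_ge_zero)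
  define \<beta> where "\<beta> t = Sp2_chart (\<phi> t, of_real (r t) * e)" for t
  have cont: "continuous_on UNIV \<phi>" "continuous_on UNIV r"
    using \<phi>(1) r(1) by (meson DERIV_isCont continuous_at_imp_continuous_on)+
  have hom: "homotopic_paths Sp2 \<alpha> \<beta>"
  proof -
    let ?p = "\<lambda>t. (Im (q t), alin (\<alpha> t))" and ?p' = "\<lambda>t. (\<phi> t, of_real (r t) * e)"
    \<comment> \<open>Both lifts have the same end points, so the linear homotopy keeps these fixed;
      its image under the chart stays in \<open>Sp2\<close>.\<close>
    have "homotopic_paths UNIV ?p ?p'"
    proof (rule homotopic_paths_linear)
      show "path ?p"
        unfolding path_def using q(1) \<alpha>(1)
        by (intro continuous_intros bounded_linear.continuous_on [OF bounded_linear_alin]) (auto simp: path_def)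
      show "path ?p'"
        unfolding path_def using cont
        by (intro continuous_intros) (auto intro: continuous_on_subset)
    qed (use bd e \<alpha>(3) in \<open>auto simp: pathstart_def pathfinish_def\<close>)
    then have "homotopic_paths Sp2 (Sp2_chart \<circ> ?p) (Sp2_chart \<circ> ?p')"
      by (rule homotopic_paths_continuous_image) (auto intro: continuous_on_Sp2_chart Sp2_chart_in_Sp2)
    moreover have "Sp2_chart \<circ> ?p' = \<beta>" by (auto simp: \<beta>_def)
    ultimately have "homotopic_paths Sp2 (Sp2_chart \<circ> ?p) \<beta>" by simp
    moreover have "homotopic_paths Sp2 \<alpha> (Sp2_chart \<circ> ?p)"
      by (rule homotopic_paths_eq) (use \<alpha> \<alpha>_chart in auto)
    ultimately show ?thesis by (rule homotopic_paths_trans [rotated])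
  qed
  define \<rho> where "\<rho> t = sqrt (1 + (r t)\<^sup>2)" for t
  define \<rho>' where "\<rho>' t = r t * r' t / \<rho> t" for t
  have \<rho>0: "\<rho> t > 0" for t by (simp add: \<rho>_def add_pos_nonneg)
  have \<rho>: "(\<rho> has_real_derivative \<rho>' t) (at t)" for t
  proof -
    have "((\<lambda>t. 1 + (r t)\<^sup>2) has_real_derivative 2 * r t * r' t) (at t)"
      using DERIV_add [OF DERIV_const DERIV_power [OF r(1), of 2]] by (simp add: mult_ac)
    then have "(\<rho> has_real_derivative inverse (\<rho> t) / 2 * (2 * r t * r' t)) (at t)"
      unfolding \<rho>_def [abs_def] by (intro DERIV_chain2 [OF DERIV_real_sqrt]) (simp_all add: add_pos_nonneg)
    then show ?thesis by (simp add: \<rho>'_def field_simps)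
  qed
  have \<rho>cont: "continuous_on UNIV \<rho>" "continuous_on UNIV \<rho>'"
  proof -
    show "continuous_on UNIV \<rho>" unfolding \<rho>_def [abs_def] by (intro continuous_intros cont)
    then show "continuous_on UNIV \<rho>'"
      unfolding \<rho>'_def [abs_def] using \<rho>0 by (intro continuous_intros cont r(2)) (auto simp: less_le)
  qed
  have \<beta>_eq: "\<beta> t = rmat (of_real (\<rho> t) * cis (\<phi> t)) (of_real (r t) * e)" for t
    by (simp add: \<beta>_def Sp2_chart_def \<rho>_def norm_mult e(1) power2_abs)
  have C1: "\<beta> C1_differentiable_on {0..1}"
    unfolding C1_differentiable_on_def
  proof (intro exI conjI ballI)
    let ?A' = "\<lambda>t. of_real (\<rho> t) * (\<phi>' t *\<^sub>R (\<i> * cis (\<phi> t))) + of_real (\<rho>' t) * cis (\<phi> t)"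
    fix t :: real
    have cis: "((\<lambda>s. cis (\<phi> s)) has_vector_derivative \<phi>' t *\<^sub>R (\<i> * cis (\<phi> t))) (at t)"
    proof -
      have "((\<lambda>s. cis s) has_vector_derivative \<i> * cis (\<phi> t)) (at (\<phi> t))"
        unfolding has_vector_derivative_def by (auto intro!: derivative_eq_intros simp: fun_eq_iff)
      then show ?thesis
        using vector_diff_chain_at [OF \<phi>(1) [unfolded has_real_derivative_iff_has_vector_derivative]]
        by (simp add: o_def)
    qed
    have ofr: "((\<lambda>s. of_real (f s) :: complex) has_vector_derivative of_real f') (at t)"
      if "(f has_real_derivative f') (at t)" for f f'
      using that unfolding has_real_derivative_iff_has_vector_derivative
      by (rule bounded_linear.has_vector_derivative [OF bounded_linear_of_real])
    have "((\<lambda>s. (of_real (\<rho> s) * cis (\<phi> s), of_real (r s) * e)) has_vector_derivative (?A' t, of_real (r' t) * e)) (at t)"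
      by (intro has_vector_derivative_Pair has_vector_derivative_mult cis ofr \<rho> r has_vector_derivative_mult_left)
    from bounded_linear.has_vector_derivative [OF bounded_linear_rmat this]
    show "(\<beta> has_vector_derivative rmat (?A' t) (of_real (r' t) * e)) (at t)"
      by (simp add: \<beta>_eq [abs_def])
  next
    show "continuous_on {0..1} (\<lambda>t. rmat (of_real (\<rho> t) * (\<phi>' t *\<^sub>R (\<i> * cis (\<phi> t))) + of_real (\<rho>' t) * cis (\<phi> t))
        (of_real (r' t) * e))"
      by (rule continuous_on_subset [of UNIV]) (auto intro!: continuous_intros cont \<rho>cont \<phi> r)
  qed
  define f where "f t = \<rho> t * cos (\<phi> t)" for t
  define f' where "f' t = \<rho>' t * cos (\<phi> t) - \<rho> t * sin (\<phi> t) * \<phi>' t" for t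
  have f: "(f has_real_derivative f' t) (at t)" for t
    using DERIV_mult [OF \<rho> DERIV_chain2 [OF DERIV_cos \<phi>(1)], of t]
    unfolding f_def [abs_def] f'_def by (simp add: mult_ac)
  have Re_\<beta>: "Re (clin (\<beta> t)) = f t" for t by (simp add: \<beta>_eq f_def)
  have \<beta>Sp: "\<beta> t \<in> Sp2" for t by (simp add: \<beta>_def Sp2_chart_in_Sp2)
  have crossing: "crossing_times \<beta> = {t \<in> {0..1}. f t = 1}"
    by (auto simp: crossing_times_def mem_Sp2_01_iff \<beta>Sp Re_\<beta>)
  have reg: "f' t \<noteq> 0" if "t \<in> {0..1}" "f t = 1" for t
    using tr [of t] that by (simp add: f_def f'_def \<rho>_def \<rho>'_def)
  have fin: "finite (crossing_times \<beta>)"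
    unfolding crossing by (rule finite_regular_level [OF f reg])
  have trans: "transverse_crossing \<beta> t" if "t \<in> crossing_times \<beta>" for t
  proof -
    have "((\<lambda>s. 2 - 2 * f s) has_real_derivative 0 - 2 * f' t) (at t)"
      by (intro DERIV_diff DERIV_const DERIV_cmult f)
    then have "deriv (\<lambda>s. det (\<beta> s - mat 1)) t = 0 - 2 * f' t"
      by (simp add: det_minus_mat_1_Sp2 \<beta>Sp Re_\<beta> DERIV_imp_deriv)
    then show ?thesis using that reg by (simp add: transverse_crossing_def crossing)
  qed
  have \<beta>ends: "\<beta> 0 = \<alpha> 0" "\<beta> 1 = \<alpha> 1"
    using homotopic_paths_imp_pathstart [OF hom] homotopic_paths_imp_pathfinish [OF hom]
    by (auto simp: pathstart_def pathfinish_def)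
  define q' where "q' t = of_real (ln (\<rho> t)) + \<i> * of_real (\<phi> t)" for t
  have q': "continuous_on {0..1} q'" "clin (\<beta> t) = exp (q' t)" for t
  proof -
    have "continuous_on UNIV q'"
      unfolding q'_def [abs_def] using \<rho>0 by (intro continuous_intros cont \<rho>cont) (auto simp: less_le)
    then show "continuous_on {0..1} q'" by (rule continuous_on_subset) auto
    show "clin (\<beta> t) = exp (q' t)"
      using \<rho>0 [of t] by (simp add: \<beta>_eq q'_def exp_add cis_conv_exp exp_of_real)
  qed
  have "(\<Sum>t\<in>crossing_times \<beta>. crossing_sign \<beta> t) = real_of_int (sheet (q' 1) - sheet (q' 0))"
    by (rule crossing_sum) (use C1 \<beta>Sp fin trans ends \<beta>ends q' in auto)
  also have "sheet (q' 1) - sheet (q' 0) = sheet (q 1) - sheet (q 0)"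
    using sheet_diff_homotopic [OF hom q q'] by simp
  finally show ?thesis
    unfolding has_intersection_number_def using hom C1 fin trans ends
    by (auto simp: pathstart_def pathfinish_def)
qed

subsection \<open>The Maslov-type index\<close>

lemma eventually_floor_left:
  assumes "c > 0"
  shows "eventually (\<lambda>\<epsilon>::real. \<lfloor>x - \<epsilon> / c\<rfloor> = \<lceil>x\<rceil> - 1) (at_right 0)"
proof -
  define k where "k = \<lceil>x\<rceil> - 1"
  have k: "of_int k < x" "x \<le> of_int k + 1" unfolding k_def by linarith+
  have "((\<lambda>\<epsilon>. x - \<epsilon> / c) \<longlongrightarrow> x - 0 / c) (at_right 0)"
    using assms by (intro tendsto_intros) auto
  then have "eventually (\<lambda>\<epsilon>. of_int k < x - \<epsilon> / c) (at_right 0)"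
    using k by (intro order_tendstoD(1)) auto
  moreover have "eventually (\<lambda>\<epsilon>::real. \<epsilon> > 0) (at_right 0)" by (rule eventually_at_right_less)
  ultimately show ?thesis
  proof eventually_elim
    case (elim \<epsilon>)
    have "\<epsilon> / c > 0" using elim assms by simp
    then have "\<lfloor>x - \<epsilon> / c\<rfloor> = k" using elim k by (intro floor_unique) auto
    then show ?case by (simp add: k_def)
  qed
qed

text \<open>Turning back by a small angle leaves the hypersurface and settles in a single sheet,
  even from a point on it. This makes the phrase "for sufficiently small \<open>\<epsilon>\<close>"
  meaningful at the end of the path. The side is decided by continuity off the hypersurface, by the
  first derivative at a regular point, and by second order where
  \<open>exp \<zeta> = 1\<close>.\<close>

lemma sheet_left_limit:
  obtains n where "eventually (\<lambda>\<epsilon>::real. sheet (\<zeta> - \<i> * \<epsilon>) = n \<and> Re (exp (\<zeta> - \<i> * \<epsilon>)) \<noteq> 1) (at_right 0)"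
proof -
  define x y where "x = Re (exp \<zeta>)" and "y = Im (exp \<zeta>)"
  define g where "g \<epsilon> = x * cos \<epsilon> + y * sin \<epsilon>" for \<epsilon>
  have g: "Re (exp (\<zeta> - \<i> * \<epsilon>)) = g \<epsilon>" for \<epsilon> :: real
    unfolding g_def x_def y_def by (simp add: Re_exp Im_exp cos_diff algebra_simps)
  have lim: "(g \<longlongrightarrow> x) (at_right 0)"
  proof -
    have "((\<lambda>\<epsilon>. x * cos \<epsilon> + y * sin \<epsilon>) \<longlongrightarrow> x * cos 0 + y * sin 0) (at_right 0)"
      by (intro tendsto_intros)
    then show ?thesis by (simp add: g_def [abs_def])
  qed
  have pos: "eventually (\<lambda>\<epsilon>::real. \<epsilon> > 0) (at_right 0)" by (rule eventually_at_right_less)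
  have der: "(g has_real_derivative y) (at 0)"
    unfolding g_def [abs_def] by (auto intro!: derivative_eq_intros)
  have side: "eventually (\<lambda>\<epsilon>. g \<epsilon> > 1) (at_right 0) \<or> eventually (\<lambda>\<epsilon>. g \<epsilon> < 1) (at_right 0)"
  proof -
    consider "x > 1" | "x < 1" | "x = 1" "y > 0" | "x = 1" "y < 0" | "x = 1" "y = 0" by linarith
    then show ?thesis
    proof cases
      case 1
      then show ?thesis using order_tendstoD(1) [OF lim] by blast
    next
      case 2
      then show ?thesis using order_tendstoD(2) [OF lim] by blast
    next
      case 3
      obtain d where d: "d > 0" "\<And>h. 0 < h \<Longrightarrow> h < d \<Longrightarrow> g 0 < g (0 + h)"
        using DERIV_pos_inc_right [OF der 3(2)] by blast
      have "eventually (\<lambda>\<epsilon>. \<epsilon> \<in> {0<..<d}) (at_right 0)"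
        using d(1) by (rule eventually_at_right_real)
      then have "eventually (\<lambda>\<epsilon>. g \<epsilon> > 1) (at_right 0)"
        by eventually_elim (use d(2) 3(1) in \<open>auto simp: g_def\<close>)
      then show ?thesis ..
    next
      case 4
      obtain d where d: "d > 0" "\<And>h. 0 < h \<Longrightarrow> h < d \<Longrightarrow> g 0 > g (0 + h)"
        using DERIV_neg_dec_right [OF der 4(2)] by blast
      have "eventually (\<lambda>\<epsilon>. \<epsilon> \<in> {0<..<d}) (at_right 0)"
        using d(1) by (rule eventually_at_right_real)
      then have "eventually (\<lambda>\<epsilon>. g \<epsilon> < 1) (at_right 0)"
        by eventually_elim (use d(2) 4(1) in \<open>auto simp: g_def\<close>)
      then show ?thesis ..
    next
      case 5
      \<comment> \<open>The first derivative vanishes here, but \<open>g\<close> is the cosine,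
        which lies below 1 for small positive angles.\<close>
      have "eventually (\<lambda>\<epsilon>. \<epsilon> \<in> {0<..<pi}) (at_right 0)"
        using pi_gt_zero by (rule eventually_at_right_real)
      then have "eventually (\<lambda>\<epsilon>. g \<epsilon> < 1) (at_right 0)"
      proof eventually_elim
        case (elim \<epsilon>)
        then have "cos \<epsilon> < cos 0" by (intro cos_monotone_0_pi) auto
        then show ?case using 5 by (simp add: g_def)
      qed
      then show ?thesis ..
    qed
  qed
  have Im: "Im (\<zeta> - \<i> * \<epsilon>) / (2*pi) = Im \<zeta> / (2*pi) - \<epsilon> / (2*pi)" for \<epsilon> :: real
    by (simp add: diff_divide_distrib)
  have fl: "eventually (\<lambda>\<epsilon>. \<lfloor>Im \<zeta> / (2*pi) - \<epsilon> / (2*pi)\<rfloor> = \<lceil>Im \<zeta> / (2*pi)\<rceil> - 1) (at_right 0)"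
    using pi_gt_zero by (intro eventually_floor_left) simp
  have "eventually (\<lambda>\<epsilon>. \<lfloor>Im \<zeta> / (2*pi) + 1/2 - \<epsilon> / (2*pi)\<rfloor> = \<lceil>Im \<zeta> / (2*pi) + 1/2\<rceil> - 1) (at_right 0)"
    using pi_gt_zero by (intro eventually_floor_left) simp
  then have rd: "eventually (\<lambda>\<epsilon>. round (Im \<zeta> / (2*pi) - \<epsilon> / (2*pi)) = \<lceil>Im \<zeta> / (2*pi) + 1/2\<rceil> - 1) (at_right 0)"
    by (simp add: round_def algebra_simps)
  from side show ?thesis
  proof
    assume "eventually (\<lambda>\<epsilon>. g \<epsilon> > 1) (at_right 0)"
    with rd have "eventually (\<lambda>\<epsilon>::real. sheet (\<zeta> - \<i> * \<epsilon>) = 2 * (\<lceil>Im \<zeta> / (2*pi) + 1/2\<rceil> - 1)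
        \<and> Re (exp (\<zeta> - \<i> * \<epsilon>)) \<noteq> 1) (at_right 0)"
      by eventually_elim (simp add: sheet_def g Im del: minus_complex.sel)
    then show ?thesis by (rule that)
  next
    assume "eventually (\<lambda>\<epsilon>. g \<epsilon> < 1) (at_right 0)"
    with fl have "eventually (\<lambda>\<epsilon>::real. sheet (\<zeta> - \<i> * \<epsilon>) = 2 * (\<lceil>Im \<zeta> / (2*pi)\<rceil> - 1) + 1
        \<and> Re (exp (\<zeta> - \<i> * \<epsilon>)) \<noteq> 1) (at_right 0)"
      by eventually_elim (simp add: sheet_def g Im del: minus_complex.sel)
    then show ?thesis by (rule that)
  qed
qed

text \<open>The perturbed path starts in sheet -1, so the intersection number is the sheet number of
  its end plus 1. The -1 in \<open>maslov_index\<close> cancels this, and the index is exactly the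
  sheet number of the slightly turned end point.\<close>

lemma sheet_start:
  assumes "0 < \<epsilon>" "\<epsilon> < pi"
  shows "sheet (- \<i> * \<epsilon>) = -1" "Re (exp (- \<i> * \<epsilon>)) \<noteq> 1"
proof -
  have "cos \<epsilon> < cos 0" using assms by (intro cos_monotone_0_pi) auto
  then have c: "cos \<epsilon> < 1" by simp
  have "\<lfloor>- \<epsilon> / (2*pi)\<rfloor> = -1" using assms by (intro floor_div_2pi_eq) auto
  then show "sheet (- \<i> * \<epsilon>) = -1" using c by (simp add: sheet_def Re_exp)
  show "Re (exp (- \<i> * \<epsilon>)) \<noteq> 1" using c by (simp add: Re_exp)
qed

text \<open>The index is the sheet number of the end point turned back by a small
  \<open>\<epsilon>\<close>. Of the error 2, one unit comes from \<open>sheet_bound\<close> and the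
  other from \<open>\<epsilon> / pi < 1\<close>.\<close>

lemma maslov_index_estimate:
  assumes T: "T \<ge> 0" and cont: "continuous_on {0..T} \<gamma>" and Sp: "\<And>t. t \<in> {0..T} \<Longrightarrow> \<gamma> t \<in> Sp2"
    and \<gamma>0: "\<gamma> 0 = mat 1"
    and q: "continuous_on {0..T} q" "q 0 = 0" "\<And>t. t \<in> {0..T} \<Longrightarrow> clin (\<gamma> t) = exp (q t)"
  shows "\<bar>real_of_int (maslov_index \<gamma> T) - Im (q T) / pi\<bar> \<le> 2"
proof -
  have resc: "(\<lambda>s. T * s) ` {0..1} \<subseteq> {0..T}" using T by (auto simp: mult_left_le)
  define Q where "Q = (\<lambda>\<epsilon> s. q (T * s) - \<i> * complex_of_real \<epsilon>)"
  have Qcont: "continuous_on {0..1} (Q \<epsilon>)" for \<epsilon>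
    unfolding Q_def using resc
    by (intro continuous_intros continuous_on_compose2 [OF q(1)]) auto
  have Qlift: "clin (perturbed_path \<gamma> T \<epsilon> s) = exp (Q \<epsilon> s)" if "s \<in> {0..1}" for \<epsilon> s
  proof -
    have "T * s \<in> {0..T}" using resc that by blast
    then show ?thesis
      using q(3) by (simp add: perturbed_path_def clin_mult Q_def exp_diff cis_conv_exp exp_minus divide_inverse)
  qed
  have PSp: "perturbed_path \<gamma> T \<epsilon> s \<in> Sp2" if "s \<in> {0..1}" for \<epsilon> s
    unfolding perturbed_path_def using resc that by (intro Sp2_mult expJ_in_Sp2 Sp) blast
  obtain n where n: "eventually (\<lambda>\<epsilon>::real. sheet (q T - \<i> * \<epsilon>) = n \<and> Re (exp (q T - \<i> * \<epsilon>)) \<noteq> 1) (at_right 0)"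
    by (rule sheet_left_limit)
  have small: "eventually (\<lambda>\<epsilon>. \<epsilon> \<in> {0<..<pi}) (at_right 0)"
    using pi_gt_zero by (rule eventually_at_right_real)
  have ev: "eventually (\<lambda>\<epsilon>. has_intersection_number (perturbed_path \<gamma> T \<epsilon>) (n + 1)) (at_right 0)"
    using n small
  proof eventually_elim
    case (elim \<epsilon>)
    have start: "Q \<epsilon> 0 = - \<i> * \<epsilon>" and fin: "Q \<epsilon> 1 = q T - \<i> * \<epsilon>" by (simp_all add: Q_def q)
    have "has_intersection_number (perturbed_path \<gamma> T \<epsilon>) (sheet (Q \<epsilon> 1) - sheet (Q \<epsilon> 0))"
    proof (rule intersection_number_exists)
      have "perturbed_path \<gamma> T \<epsilon> = (\<lambda>s. rmat (cis (- \<epsilon>) * clin (\<gamma> (T * s))) (cis (- \<epsilon>) * alin (\<gamma> (T * s))))"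
        by (rule ext, rule sym) (simp add: perturbed_path_def rmat_eq_iff clin_mult alin_mult)
      moreover have "continuous_on {0..1} (\<lambda>s. \<gamma> (T * s))"
        using resc by (intro continuous_on_compose2 [OF cont] continuous_intros) auto
      ultimately show "path (perturbed_path \<gamma> T \<epsilon>)"
        unfolding path_def
        by (auto intro!: continuous_intros bounded_linear.continuous_on [OF bounded_linear_clin]
            bounded_linear.continuous_on [OF bounded_linear_alin])
      show "path_image (perturbed_path \<gamma> T \<epsilon>) \<subseteq> Sp2"
        using PSp by (auto simp: path_image_def)
      show "alin (perturbed_path \<gamma> T \<epsilon> 0) = 0"
        by (simp add: perturbed_path_def \<gamma>0 alin_mult)
      show "perturbed_path \<gamma> T \<epsilon> 0 \<notin> Sp2_01" "perturbed_path \<gamma> T \<epsilon> 1 \<notin> Sp2_01"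
        using elim sheet_start [of \<epsilon>] by (simp_all add: mem_Sp2_01_iff Qlift start fin)
    qed (use Qcont Qlift in auto)
    then show ?case
      using elim sheet_start [of \<epsilon>] unfolding start fin by simp
  qed
  have "iota \<gamma> T = n + 1"
    unfolding iota_def
  proof (rule the_equality, rule ev)
    fix m assume "eventually (\<lambda>\<epsilon>. has_intersection_number (perturbed_path \<gamma> T \<epsilon>) m) (at_right 0)"
    with ev have "eventually (\<lambda>\<epsilon>::real. m = n + 1) (at_right 0)"
      by eventually_elim (metis intersection_number_eq Qcont Qlift)
    then show "m = n + 1" by simp
  qed
  then have mas: "maslov_index \<gamma> T = n" by (simp add: maslov_index_def)
  have "eventually (\<lambda>\<epsilon>. sheet (q T - \<i> * complex_of_real \<epsilon>) = n \<and> \<epsilon> \<in> {0<..<pi}) (at_right 0)"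
    using n small by eventually_elim auto
  then obtain \<epsilon> :: real where \<epsilon>: "sheet (q T - \<i> * complex_of_real \<epsilon>) = n" "0 < \<epsilon>" "\<epsilon> < pi"
    using eventually_happens' [OF trivial_limit_at_right_real [of 0]] by fastforce
  have "\<bar>real_of_int n - (Im (q T) / pi - \<epsilon> / pi)\<bar> \<le> 1"
    using sheet_bound [of "q T - \<i> * \<epsilon>"] by (simp add: \<epsilon>(1) diff_divide_distrib)
  moreover have "0 < \<epsilon> / pi" "\<epsilon> / pi < 1" using \<epsilon> by auto
  ultimately show ?thesis unfolding mas by linarith
qed

subsection \<open>The linear system in complex form\<close>

text \<open>By the intermediate value theorem the function cannot leave the component of the set of
  positive cosine in which it starts, and this component is an interval of length pi.\<close>

lemma cos_pos_imp_displacement_less_pi: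
  fixes f :: "real \<Rightarrow> real"
  assumes T: "T \<ge> 0" and cont: "continuous_on {0..T} f" and pos: "\<And>t. t \<in> {0..T} \<Longrightarrow> cos (f t) > 0"
  shows "\<bar>f T - f 0\<bar> < pi"
proof -
  have "cos (f 0) > 0" using pos [of 0] T by simp
  then obtain k :: int where k: "\<bar>f 0 - 2*pi * of_int k\<bar> < pi/2"
    using near_multiple_of_2pi by metis
  define g where "g t = f t - 2*pi * of_int k" for t
  have gcont: "continuous_on {0..T} g" unfolding g_def by (intro continuous_intros cont)
  have gpos: "cos (g t) > 0" if "t \<in> {0..T}" for t
    using pos [OF that] by (simp add: g_def cos_diff)
  have g0: "\<bar>g 0\<bar> < pi/2" using k by (simp add: g_def)
  have no: "g t \<noteq> pi/2" "g t \<noteq> - (pi/2)" if "t \<in> {0..T}" for t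
    using gpos [OF that] by (metis cos_minus cos_pi_half less_irrefl)+
  have "g T < pi/2"
  proof (rule ccontr)
    assume "\<not> g T < pi/2"
    then obtain t where "0 \<le> t" "t \<le> T" "g t = pi/2"
      using IVT' [of g 0 "pi/2" T] gcont abs_less_iff [THEN iffD1, OF g0] T by auto
    then show False using no by auto
  qed
  moreover have "- (pi/2) < g T"
  proof (rule ccontr)
    assume "\<not> - (pi/2) < g T"
    then obtain t where "0 \<le> t" "t \<le> T" "g t = - (pi/2)"
      using IVT2' [of g T "- (pi/2)" 0] gcont abs_less_iff [THEN iffD1, OF g0] T by auto
    then show False using no by auto
  qed
  ultimately have "\<bar>g T - g 0\<bar> < pi" using g0 by linarith
  then show ?thesis by (simp add: g_def)
qed

text \<open>The argument is that of Rouche's theorem: the quotient of the two exponentials stays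
  within distance 1 of 1, hence in the right half-plane, so the difference of the arguments keeps a
  positive cosine.\<close>

lemma lift_displacement_less_pi:
  fixes f g :: "real \<Rightarrow> complex"
  assumes T: "T \<ge> 0" and cont: "continuous_on {0..T} f" "continuous_on {0..T} g"
    and split: "\<And>t. t \<in> {0..T} \<Longrightarrow> norm (exp (f t) - exp (g t)) < norm (exp (g t))"
  shows "\<bar>(Im (f T) - Im (f 0)) - (Im (g T) - Im (g 0))\<bar> < pi"
proof -
  have "\<bar>(Im (f T) - Im (g T)) - (Im (f 0) - Im (g 0))\<bar> < pi"
  proof (rule cos_pos_imp_displacement_less_pi [OF T])
    show "continuous_on {0..T} (\<lambda>t. Im (f t) - Im (g t))" by (intro continuous_intros cont)
    fix t assume t: "t \<in> {0..T}"
    have "exp (f t - g t) - 1 = (exp (f t) - exp (g t)) / exp (g t)"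
      by (simp add: exp_diff diff_divide_distrib)
    then have "norm (exp (f t - g t) - 1) < 1"
      using split [OF t] by (simp add: norm_divide del: norm_exp_eq_Re)
    then have "\<bar>Re (exp (f t - g t) - 1)\<bar> < 1"
      using abs_Re_le_cmod order_le_less_trans by blast
    then have "Re (exp (f t - g t)) > 0" by simp
    then show "cos (Im (f t) - Im (g t)) > 0"
      by (simp add: Re_exp zero_less_mult_iff)
  qed
  then show ?thesis by (simp add: algebra_simps)
qed

text \<open>In the complex notation \<open>M z = a z + b z\<^sup>*\<close>, a symmetric matrix has a real coefficient
  \<open>h\<close> in the place of \<open>a\<close>, and \<open>J\<close> is multiplication by \<open>\<i>\<close>.\<close>

definition complex_fundamental :: "(real \<Rightarrow> real) \<Rightarrow> (real \<Rightarrow> complex) \<Rightarrow> (real \<Rightarrow> complex) \<Rightarrow> (real \<Rightarrow> complex) \<Rightarrow> bool" where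
  "complex_fundamental h k a b \<longleftrightarrow>
     (\<forall>t. (a has_vector_derivative \<i> * (of_real (h t) * a t + k t * cnj (b t))) (at t)) \<and>
     (\<forall>t. (b has_vector_derivative \<i> * (of_real (h t) * b t + k t * cnj (a t))) (at t)) \<and>
     a 0 = 1 \<and> b 0 = 0"

lemma has_vector_derivative_cnj':
  "(f has_vector_derivative f') (at t) \<Longrightarrow> ((\<lambda>t. cnj (f t)) has_vector_derivative cnj f') (at t)"
  by (rule bounded_linear.has_vector_derivative [OF bounded_linear_cnj])

context
  fixes h :: "real \<Rightarrow> real" and k a b :: "real \<Rightarrow> complex"
  assumes fund: "complex_fundamental h k a b"
begin

lemma fund_deriv:
  "(a has_vector_derivative \<i> * (of_real (h t) * a t + k t * cnj (b t))) (at t)"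
  "(b has_vector_derivative \<i> * (of_real (h t) * b t + k t * cnj (a t))) (at t)"
  and fund_init: "a 0 = 1" "b 0 = 0"
  using fund by (auto simp: complex_fundamental_def)

lemma fund_deriv_cnj:
  "((\<lambda>t. cnj (a t)) has_vector_derivative - \<i> * (of_real (h t) * cnj (a t) + cnj (k t) * b t)) (at t)"
  "((\<lambda>t. cnj (b t)) has_vector_derivative - \<i> * (of_real (h t) * cnj (b t) + cnj (k t) * a t)) (at t)"
  using has_vector_derivative_cnj' [OF fund_deriv(1) [of t]] has_vector_derivative_cnj' [OF fund_deriv(2) [of t]]
  by simp_all

lemma fund_det: "a t * cnj (a t) - b t * cnj (b t) = 1"
proof -
  have "((\<lambda>t. a t * cnj (a t) - b t * cnj (b t)) has_vector_derivative 0) (at t within UNIV)" for t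
    by (rule has_vector_derivative_eq_rhs)
      (rule has_vector_derivative_diff has_vector_derivative_mult fund_deriv fund_deriv_cnj | simp add: algebra_simps)+
  then obtain c where c: "\<And>t. t \<in> UNIV \<Longrightarrow> a t * cnj (a t) - b t * cnj (b t) = c"
    using has_vector_derivative_zero_constant [of UNIV "\<lambda>t. a t * cnj (a t) - b t * cnj (b t)"] by auto
  then show ?thesis using c [of 0] c [of t] fund_init by simp
qed

lemma fund_norm: "(norm (a t))\<^sup>2 = 1 + (norm (b t))\<^sup>2"
proof -
  have "complex_of_real ((norm (a t))\<^sup>2 - (norm (b t))\<^sup>2) = 1"
    using fund_det [of t] unfolding of_real_diff complex_norm_square .
  then have "(norm (a t))\<^sup>2 - (norm (b t))\<^sup>2 = 1" by (simp only: of_real_eq_1_iff)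
  then show ?thesis by simp
qed

lemma fund_norm_less: "norm (b t) < norm (a t)"
  by (rule power2_less_imp_less) (simp_all add: fund_norm)

lemma fund_nz: "a t \<noteq> 0"
  using fund_norm_less [of t] by auto

lemma fund_cont: "continuous_on X a" "continuous_on X b"
  using fund_deriv by (meson continuous_at_imp_continuous_on has_vector_derivative_continuous)+

lemma fund_lift:
  obtains q where "continuous_on UNIV q" "\<And>t. a t = exp (q t)" "q 0 = 0"
proof -
  obtain p where p: "continuous_on UNIV p" "\<And>t. a t = exp (p t)"
    using continuous_logarithm_on_contractible [OF fund_cont(1) contractible_UNIV] fund_nz by auto
  have "exp (p 0) = 1" using p(2) [of 0] fund_init by simp
  then show ?thesis
    using p by (intro that [of "\<lambda>t. p t - p 0"]) (auto intro!: continuous_intros simp: exp_diff)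
qed

text \<open>The lift is only assumed continuous. Near \<open>t\<close> it must agree with a branch
  built from the principal logarithm, and it inherits the derivative of that branch.\<close>

lemma fund_lift_deriv:
  assumes q: "continuous_on UNIV q" "\<And>t. a t = exp (q t)"
  shows "(q has_vector_derivative \<i> * (of_real (h t) + k t * cnj (b t) / a t)) (at t)"
proof -
  define l where "l s = q t + Ln (a s / a t)" for s
  have "isCont q t" using q(1) by (simp add: continuous_on_eq_continuous_at)
  \<comment> \<open>A variation below 1 keeps the imaginary part inside the strip where
    \<open>Ln\<close> inverts \<open>exp\<close>.\<close>
  then obtain d where d: "d > 0" "\<And>s. dist s t < d \<Longrightarrow> dist (q s) (q t) < 1"
    unfolding continuous_at by (metis zero_less_one continuous_at \<open>isCont q t\<close> continuous_at_eps_delta)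
  have eq: "l s = q s" if "s \<in> ball t d" for s
  proof -
    have "norm (q s - q t) < 1" using d(2) [of s] that by (simp add: dist_commute dist_norm)
    then have "\<bar>Im (q s - q t)\<bar> < 1" using abs_Im_le_cmod order_le_less_trans by blast
    then have "Ln (exp (q s - q t)) = q s - q t" using pi_gt3 by (intro Ln_exp) auto
    then show ?thesis by (simp add: l_def q(2) exp_diff)
  qed
  have "((\<lambda>s. a s / a t) has_vector_derivative \<i> * (of_real (h t) * a t + k t * cnj (b t)) / a t) (at t)"
    by (intro has_vector_derivative_divide fund_deriv)
  moreover have "(Ln has_field_derivative 1) (at (a t / a t))"
    using has_field_derivative_Ln [of 1] fund_nz by simp
  ultimately have "(Ln \<circ> (\<lambda>s. a s / a t) has_vector_derivative
      \<i> * (of_real (h t) * a t + k t * cnj (b t)) / a t * 1) (at t)"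
    by (rule field_vector_diff_chain_at)
  then have "(l has_vector_derivative 0 + \<i> * (of_real (h t) * a t + k t * cnj (b t)) / a t) (at t)"
    unfolding l_def [abs_def] by (intro has_vector_derivative_add has_vector_derivative_const) (simp add: o_def)
  then have "(q has_vector_derivative 0 + \<i> * (of_real (h t) * a t + k t * cnj (b t)) / a t) (at t)"
    by (rule has_vector_derivative_transform_within_open [where S = "ball t d"]) (use d eq in auto)
  moreover have "0 + \<i> * (of_real (h t) * a t + k t * cnj (b t)) / a t = \<i> * (of_real (h t) + k t * cnj (b t) / a t)"
    using fund_nz [of t] by (simp add: field_simps)
  ultimately show ?thesis by simp
qed

text \<open>The logarithmic derivative involves b only through the quotient of its conjugate by a,
  which has norm below 1. The speed is therefore at most \<open>2 * K\<close> even where a and b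
  grow exponentially.\<close>

lemma fund_lift_Lipschitz:
  assumes q: "continuous_on UNIV q" "\<And>t. a t = exp (q t)"
    and K: "\<And>t. \<bar>h t\<bar> \<le> K" "\<And>t. norm (k t) \<le> K"
  shows "\<bar>Im (q t) - Im (q s)\<bar> \<le> 2 * K * \<bar>t - s\<bar>"
proof -
  have "norm (q t - q s) \<le> (2 * K) * norm (t - s)"
  proof (rule differentiable_bound [of UNIV q "\<lambda>t x. x *\<^sub>R (\<i> * (of_real (h t) + k t * cnj (b t) / a t))"])
    fix t
    show "(q has_derivative (\<lambda>x. x *\<^sub>R (\<i> * (of_real (h t) + k t * cnj (b t) / a t)))) (at t within UNIV)"
      using fund_lift_deriv [OF q] by (simp add: has_vector_derivative_def)
    have "norm (cnj (b t) / a t) \<le> 1"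
      using fund_norm_less [of t] fund_nz [of t] by (simp add: norm_divide)
    then have "norm (k t) * norm (cnj (b t) / a t) \<le> K * 1"
      using K(2) [of t] by (intro mult_mono) (auto intro: order_trans [OF norm_ge_zero])
    then have "norm (k t * cnj (b t) / a t) \<le> K"
      by (simp add: norm_mult norm_divide)
    then have "norm (\<i> * (of_real (h t) + k t * cnj (b t) / a t)) \<le> 2 * K"
      using K(1) [of t] norm_triangle_ineq [of "of_real (h t)" "k t * cnj (b t) / a t"]
      by (simp add: norm_mult)
    then show "onorm (\<lambda>x. x *\<^sub>R (\<i> * (of_real (h t) + k t * cnj (b t) / a t))) \<le> 2 * K"
      by (intro onorm_le) (simp add: mult.commute mult_left_mono)
  qed auto
  moreover have "\<bar>Im (q t) - Im (q s)\<bar> \<le> norm (q t - q s)"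
    using abs_Im_le_cmod [of "q t - q s"] by simp
  ultimately show ?thesis by simp
qed

text \<open>Gronwall for the sum E of the squared norms. The coefficient \<open>h\<close> acts as a
  rotation and cancels in the derivative, while \<open>k\<close> contributes at most
  \<open>4 * K\<close> |a| |b|, which is at most \<open>2 * K * E\<close>.\<close>

lemma fund_growth:
  assumes K: "\<And>t. norm (k t) \<le> K" and t: "t \<ge> 0"
  shows "(norm (a t))\<^sup>2 + (norm (b t))\<^sup>2 \<le> exp (2 * K * t)"
proof -
  define E where "E t = Re (a t * cnj (a t) + b t * cnj (b t))" for t
  have E_eq: "E t = (norm (a t))\<^sup>2 + (norm (b t))\<^sup>2" for t
    by (simp add: E_def complex_norm_square [symmetric] del: Re_complex_of_real) (simp add: cmod_power2 power2_eq_square)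
  define E' where "E' t = - 4 * Im (k t * cnj (a t) * cnj (b t))" for t
  have E: "(E has_real_derivative E' t) (at t)" for t
  proof -
    have "((\<lambda>t. a t * cnj (a t) + b t * cnj (b t)) has_vector_derivative
        2 * \<i> * (k t * cnj (a t) * cnj (b t) - cnj (k t * cnj (a t) * cnj (b t)))) (at t)"
      by (rule has_vector_derivative_eq_rhs)
      (rule has_vector_derivative_add has_vector_derivative_mult fund_deriv fund_deriv_cnj | simp add: algebra_simps)+
    from bounded_linear.has_vector_derivative [OF bounded_linear_Re this]
    show ?thesis
      unfolding has_real_derivative_iff_has_vector_derivative E_def [abs_def] E'_def
      by (rule has_vector_derivative_eq_rhs) (simp add: algebra_simps)
  qed
  have bound: "E' t \<le> 2 * K * E t" for t
  proof -
    have "E' t \<le> 4 * (norm (k t) * (norm (a t) * norm (b t)))"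
      using abs_Im_le_cmod [of "k t * cnj (a t) * cnj (b t)"] by (simp add: E'_def norm_mult)
    also have "\<dots> \<le> 4 * (K * (norm (a t) * norm (b t)))"
      by (intro mult_left_mono mult_right_mono K) auto
    also have "\<dots> \<le> 2 * K * E t"
    proof -
      have "2 * (norm (a t) * norm (b t)) \<le> E t"
        unfolding E_eq using sum_squares_bound [of "norm (a t)" "norm (b t)"] by simp
      moreover have "K \<ge> 0" using K [of t] norm_ge_zero order_trans by blast
      ultimately have "K * (2 * (norm (a t) * norm (b t))) \<le> K * E t" by (rule mult_left_mono)
      then show ?thesis by simp
    qed
    finally show ?thesis .
  qed
  have "E t * exp (- (2 * K * t)) \<le> E 0 * exp (- (2 * K * 0))"
  proof (rule DERIV_nonpos_imp_nonincreasing [OF t])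
    fix s
    have "((\<lambda>s. E s * exp (- (2 * K * s))) has_real_derivative
        E' s * exp (- (2 * K * s)) + exp (- (2 * K * s)) * - (2 * K) * E s) (at s)"
      by (intro DERIV_mult E) (auto intro!: derivative_eq_intros)
    moreover have "E' s * exp (- (2 * K * s)) + exp (- (2 * K * s)) * - (2 * K) * E s
        = exp (- (2 * K * s)) * (E' s - 2 * K * E s)"
      by (simp add: algebra_simps)
    moreover have "\<dots> \<le> 0" using bound [of s] by (intro mult_nonneg_nonpos) auto
    ultimately show "\<exists>y. ((\<lambda>s. E s * exp (- (2 * K * s))) has_real_derivative y) (at s) \<and> y \<le> 0"
      by metis
  qed
  then have "E t / exp (2 * K * t) \<le> 1"
    using fund_init by (simp add: E_def exp_minus divide_inverse)
  then show ?thesis by (simp add: E_eq)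
qed

text \<open>The two functions are the coefficients of \<gamma>(s + t) times the inverse of
  \<gamma>(s): for determinant 1 the inverse has coefficients \<open>cnj a\<close> and
  \<open>- b\<close>.\<close>

lemma fund_shift:
  "complex_fundamental (\<lambda>t. h (s + t)) (\<lambda>t. k (s + t))
     (\<lambda>t. a (s + t) * cnj (a s) - b (s + t) * cnj (b s)) (\<lambda>t. b (s + t) * a s - a (s + t) * b s)"
proof -
  have shift: "((\<lambda>t. f (s + t)) has_vector_derivative f' (s + t)) (at t)"
    if "\<And>t. (f has_vector_derivative f' t) (at t)" for f f' :: "real \<Rightarrow> complex" and t
  proof -
    have "((\<lambda>t. s + t) has_vector_derivative 1) (at t)" by (auto intro!: derivative_eq_intros)
    from vector_diff_chain_at [OF this that] show ?thesis by (simp add: o_def)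
  qed
  note a = shift [where f = a, OF fund_deriv(1)] and b = shift [where f = b, OF fund_deriv(2)]
  show ?thesis
    unfolding complex_fundamental_def
  proof (intro conjI allI)
    fix t
    show "((\<lambda>t. a (s + t) * cnj (a s) - b (s + t) * cnj (b s)) has_vector_derivative
        \<i> * (of_real (h (s + t)) * (a (s + t) * cnj (a s) - b (s + t) * cnj (b s)) +
        k (s + t) * cnj (b (s + t) * a s - a (s + t) * b s))) (at t)"
      by (rule has_vector_derivative_eq_rhs)
      (rule has_vector_derivative_diff has_vector_derivative_mult_left a b | simp add: algebra_simps)+
    show "((\<lambda>t. b (s + t) * a s - a (s + t) * b s) has_vector_derivative
        \<i> * (of_real (h (s + t)) * (b (s + t) * a s - a (s + t) * b s) +
        k (s + t) * cnj (a (s + t) * cnj (a s) - b (s + t) * cnj (b s)))) (at t)"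
      by (rule has_vector_derivative_eq_rhs)
      (rule has_vector_derivative_diff has_vector_derivative_mult_left a b | simp add: algebra_simps)+
  qed (use fund_det [of s] in \<open>simp_all add: mult.commute\<close>)
qed

text \<open>Every solution is a * c0 + b * cnj c0 for a constant c0, and the first term dominates,
  so its argument follows that of a. The bound is independent of the solution and of
  \<open>T\<close>.\<close>

lemma fund_solution_displacement:
  assumes q: "continuous_on UNIV q" "\<And>t. a t = exp (q t)"
    and z: "\<And>t. (z has_vector_derivative \<i> * (of_real (h t) * z t + k t * cnj (z t))) (at t)"
      "z s \<noteq> 0"
    and \<theta>: "continuous_on UNIV \<theta>" "\<And>t. is_Arg (z t) (\<theta> t)" and T: "T \<ge> 0"
  shows "\<bar>(\<theta> T - \<theta> 0) - (Im (q T) - Im (q 0))\<bar> < pi"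
proof -
  \<comment> \<open>This is the inverse of the fundamental solution applied to z, hence
    constant.\<close>
  define c where "c t = cnj (a t) * z t - b t * cnj (z t)" for t
  have "(c has_vector_derivative 0) (at t within UNIV)" for t
    unfolding c_def [abs_def]
    by (rule has_vector_derivative_eq_rhs)
      (rule has_vector_derivative_diff has_vector_derivative_mult fund_deriv fund_deriv_cnj z has_vector_derivative_cnj' | simp add: algebra_simps)+
  then obtain c0 where c: "\<And>t. c t = c0"
    using has_vector_derivative_zero_constant [of UNIV c] by auto
  have z_eq: "z t = a t * c0 + b t * cnj c0" for t
  proof -
    have "a t * c t + b t * cnj (c t) = (a t * cnj (a t) - b t * cnj (b t)) * z t"
      by (simp add: c_def algebra_simps)
    then show ?thesis by (simp add: c fund_det)
  qed
  have c0: "c0 \<noteq> 0" using z(2) z_eq [of s] by auto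
  have less: "norm (b t * cnj c0) < norm (a t * c0)" for t
    using fund_norm_less [of t] c0 by (simp add: norm_mult)
  have znz: "z t \<noteq> 0" for t
    using less [of t] z_eq [of t] by (metis add_eq_0_iff less_irrefl norm_minus_cancel)
  have zcont: "continuous_on {0..T} z"
    using z(1) by (meson continuous_at_imp_continuous_on has_vector_derivative_continuous)
  \<comment> \<open>A continuous logarithm of z whose imaginary part is the given argument.\<close>
  define p where "p t = of_real (ln (norm (z t))) + \<i> * of_real (\<theta> t)" for t
  have exp_p: "exp (p t) = z t" for t
  proof -
    have "exp (p t) = of_real (norm (z t)) * exp (\<i> * of_real (\<theta> t))"
      using znz [of t] by (simp add: p_def exp_add exp_of_real)
    also have "\<dots> = z t" using \<theta>(2) [of t] by (simp add: is_Arg_def)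
    finally show ?thesis .
  qed
  have "\<bar>(Im (p T) - Im (p 0)) - (Im (q T + Ln c0) - Im (q 0 + Ln c0))\<bar> < pi"
  proof (rule lift_displacement_less_pi [OF T])
    show "continuous_on {0..T} p"
      unfolding p_def [abs_def] using znz
      by (intro continuous_intros zcont continuous_on_subset [OF \<theta>(1)]) auto
    show "continuous_on {0..T} (\<lambda>t. q t + Ln c0)"
      by (intro continuous_intros continuous_on_subset [OF q(1)]) auto
    fix t
    have "exp (q t + Ln c0) = a t * c0" using c0 by (simp add: exp_add q(2))
    then show "norm (exp (p t) - exp (q t + Ln c0)) < norm (exp (q t + Ln c0))"
      using less [of t] by (simp add: exp_p z_eq del: norm_exp_eq_Re)
  qed
  then show ?thesis by (simp add: p_def)
qed

end

text \<open>The quasimorphism property of the angle: in the product of the transition from s to s +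
  t with the state at s, the complex-linear coefficient is A * a(s) + B * cnj (b(s)), and |B| < |A|
  together with |b(s)| < |a(s)| makes the first term dominant.\<close>

lemma fund_shift_displacement:
  assumes fund: "complex_fundamental h k a b"
    and q: "continuous_on UNIV q" "\<And>t. a t = exp (q t)"
    and p: "continuous_on UNIV p" "\<And>t. a (s + t) * cnj (a s) - b (s + t) * cnj (b s) = exp (p t)"
    and T: "T \<ge> 0"
  shows "\<bar>(Im (q (s + T)) - Im (q s)) - (Im (p T) - Im (p 0))\<bar> < pi"
proof -
  have "\<bar>(Im (q (s + T)) - Im (q (s + 0))) - (Im (p T + q s) - Im (p 0 + q s))\<bar> < pi"
  proof (rule lift_displacement_less_pi [OF T])
    show "continuous_on {0..T} (\<lambda>t. q (s + t))"
      by (intro continuous_on_compose2 [OF q(1)] continuous_intros) auto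
    show "continuous_on {0..T} (\<lambda>t. p t + q s)"
      by (intro continuous_intros continuous_on_subset [OF p(1)]) auto
    fix t
    define B where "B = b (s + t) * a s - a (s + t) * b s"
    have eq: "exp (q (s + t)) = exp (p t + q s) + B * cnj (b s)"
    proof -
      have "exp (p t + q s) + B * cnj (b s) = a (s + t) * (a s * cnj (a s) - b s * cnj (b s))"
        by (simp add: exp_add q(2) [symmetric] p(2) [symmetric] B_def algebra_simps)
      then show ?thesis by (simp add: fund_det [OF fund] q(2) [symmetric])
    qed
    have "norm B < norm (exp (p t))"
      using fund_norm_less [OF fund_shift [OF fund], of s t] by (simp only: B_def p(2))
    moreover have "norm (b s) < norm (a s)" by (rule fund_norm_less [OF fund])
    ultimately have "norm B * norm (b s) < norm (exp (p t)) * norm (a s)"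
      by (intro mult_strict_mono') auto
    then show "norm (exp (q (s + t)) - exp (p t + q s)) < norm (exp (p t + q s))"
      by (simp add: eq norm_mult exp_add q(2) del: norm_exp_eq_Re)
  qed
  then show ?thesis by simp
qed


text \<open>The second solution is the first one times a relative factor, whose complex-linear
  coefficient \<open>\<alpha>\<close> stays near 1 on the window. The domination principle costs pi
  and the principal argument of \<open>\<alpha>\<close> at the end less than pi/2.\<close>

lemma fund_compare:
  assumes f1: "complex_fundamental h1 k1 a1 b1" and f2: "complex_fundamental h2 k2 a2 b2"
    and K: "\<And>t. norm (k1 t) \<le> K" "\<And>t. norm (k2 t) \<le> K"
    and \<delta>: "\<And>t. \<bar>h2 t - h1 t\<bar> \<le> \<delta>" "\<And>t. norm (k2 t - k1 t) \<le> \<delta>"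
    and T: "T \<ge> 0" "2 * \<delta> * exp (2 * K * T) * T < 1"
    and q1: "continuous_on UNIV q1" "\<And>t. a1 t = exp (q1 t)"
    and q2: "continuous_on UNIV q2" "\<And>t. a2 t = exp (q2 t)"
  shows "\<bar>(Im (q2 T) - Im (q2 0)) - (Im (q1 T) - Im (q1 0))\<bar> < 2 * pi"
proof -
  \<comment> \<open>The complex-linear coefficient of the inverse of the first fundamental solution
    times the second.\<close>
  define \<alpha> where "\<alpha> t = cnj (a1 t) * a2 t - b1 t * cnj (b2 t)" for t
  \<comment> \<open>Only differences of the coefficients survive in the derivative. Each is at most
    \<open>\<delta>\<close>, and the remaining factors are controlled by
    \<open>fund_growth\<close>.\<close>
  define \<alpha>' where "\<alpha>' t = \<i> * (of_real (h2 t - h1 t) * (cnj (a1 t) * a2 t + b1 t * cnj (b2 t)) +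
      (k2 t - k1 t) * (cnj (a1 t) * cnj (b2 t)) + cnj (k2 t - k1 t) * (b1 t * a2 t))" for t
  have \<alpha>: "(\<alpha> has_vector_derivative \<alpha>' t) (at t)" for t
    unfolding \<alpha>_def [abs_def] \<alpha>'_def
    by (rule has_vector_derivative_eq_rhs)
      (rule has_vector_derivative_diff has_vector_derivative_mult fund_deriv [OF f1] fund_deriv [OF f2]
        fund_deriv_cnj [OF f1] fund_deriv_cnj [OF f2] | simp add: algebra_simps)+
  have K0: "K \<ge> 0" using K(1) [of 0] norm_ge_zero order_trans by blast
  have \<delta>0: "\<delta> \<ge> 0" using \<delta>(2) [of 0] norm_ge_zero order_trans by blast
  have \<alpha>'_bound: "norm (\<alpha>' t) \<le> 2 * \<delta> * exp (2 * K * T)" if t: "t \<in> {0..T}" for t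
  proof -
    define x1 y1 x2 y2 where "x1 = norm (a1 t)" and "y1 = norm (b1 t)" and "x2 = norm (a2 t)" and "y2 = norm (b2 t)"
    have nn: "x1 \<ge> 0" "y1 \<ge> 0" "x2 \<ge> 0" "y2 \<ge> 0" by (simp_all add: x1_def y1_def x2_def y2_def)
    have le: "exp (2 * K * t) \<le> exp (2 * K * T)" using K0 t by (simp add: mult_left_mono)
    have E: "x1\<^sup>2 + y1\<^sup>2 \<le> exp (2 * K * T)" "x2\<^sup>2 + y2\<^sup>2 \<le> exp (2 * K * T)"
      using order_trans [OF fund_growth [OF f1 K(1), of t] le] order_trans [OF fund_growth [OF f2 K(2), of t] le] t
      by (simp_all add: x1_def y1_def x2_def y2_def)
    have "norm (\<alpha>' t) \<le> norm (of_real (h2 t - h1 t) * (cnj (a1 t) * a2 t + b1 t * cnj (b2 t))) +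
        norm ((k2 t - k1 t) * (cnj (a1 t) * cnj (b2 t))) + norm (cnj (k2 t - k1 t) * (b1 t * a2 t))"
      unfolding \<alpha>'_def norm_mult [of \<i>] norm_ii mult_1
      by (rule order_trans [OF norm_triangle_ineq add_right_mono [OF norm_triangle_ineq]])
    also have "\<dots> \<le> \<delta> * (x1 * x2 + y1 * y2) + \<delta> * (x1 * y2) + \<delta> * (y1 * x2)"
    proof (intro add_mono)
      have "norm (cnj (a1 t) * a2 t + b1 t * cnj (b2 t)) \<le> x1 * x2 + y1 * y2"
        by (rule order_trans [OF norm_triangle_ineq]) (simp add: norm_mult x1_def x2_def y1_def y2_def)
      then show "norm (of_real (h2 t - h1 t) * (cnj (a1 t) * a2 t + b1 t * cnj (b2 t))) \<le> \<delta> * (x1 * x2 + y1 * y2)"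
        unfolding norm_mult [of "of_real (h2 t - h1 t)"] norm_of_real using \<delta> \<delta>0 by (intro mult_mono) auto
      show "norm ((k2 t - k1 t) * (cnj (a1 t) * cnj (b2 t))) \<le> \<delta> * (x1 * y2)"
        unfolding norm_mult complex_mod_cnj x1_def y2_def using \<delta> by (intro mult_right_mono) auto
      show "norm (cnj (k2 t - k1 t) * (b1 t * a2 t)) \<le> \<delta> * (y1 * x2)"
        unfolding norm_mult complex_mod_cnj x2_def y1_def using \<delta> by (intro mult_right_mono) auto
    qed
    also have "\<dots> = \<delta> * ((x1 + y1) * (x2 + y2))" by (simp add: algebra_simps)
    also have "\<delta> * ((x1 + y1) * (x2 + y2)) \<le> \<delta> * (2 * exp (2 * K * T))"
    proof (rule mult_left_mono [OF _ \<delta>0])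
      have sq: "(x + y)\<^sup>2 \<le> 2 * exp (2 * K * T)" if "x\<^sup>2 + y\<^sup>2 \<le> exp (2 * K * T)" for x y :: real
        using that sum_squares_bound [of x y] by (simp add: power2_sum)
      have "2 * ((x1 + y1) * (x2 + y2)) \<le> (x1 + y1)\<^sup>2 + (x2 + y2)\<^sup>2"
        using sum_squares_bound [of "x1 + y1" "x2 + y2"] by (simp only: mult.assoc)
      also have "\<dots> \<le> 2 * exp (2 * K * T) + 2 * exp (2 * K * T)"
        by (intro add_mono sq E)
      also have "\<dots> = 2 * (2 * exp (2 * K * T))" by simp
      finally show "(x1 + y1) * (x2 + y2) \<le> 2 * exp (2 * K * T)"
        by (simp only: mult_le_cancel_left_pos zero_less_numeral)
    qed
    finally show ?thesis by (simp only: mult_ac)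
  qed
  have \<alpha>_near: "norm (\<alpha> t - 1) < 1" if t: "t \<in> {0..T}" for t
  proof -
    have "norm (\<alpha> t - \<alpha> 0) \<le> (2 * \<delta> * exp (2 * K * T)) * norm (t - 0)"
    proof (rule differentiable_bound [of "{0..T}" \<alpha> "\<lambda>t x. x *\<^sub>R \<alpha>' t"])
      fix s assume s: "s \<in> {0..T}"
      show "(\<alpha> has_derivative (\<lambda>x. x *\<^sub>R \<alpha>' s)) (at s within {0..T})"
        using \<alpha> [of s] has_derivative_at_withinI by (auto simp: has_vector_derivative_def)
      show "onorm (\<lambda>x. x *\<^sub>R \<alpha>' s) \<le> 2 * \<delta> * exp (2 * K * T)"
        using \<alpha>'_bound [OF s] by (intro onorm_le) (simp add: mult.commute mult_left_mono)
    qed (use t T in auto)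
    also have "\<dots> \<le> (2 * \<delta> * exp (2 * K * T)) * T"
      using t \<delta>0 by (intro mult_left_mono) auto
    also have "\<dots> < 1" using T by simp
    finally show ?thesis
      using fund_init [OF f1] fund_init [OF f2] by (simp add: \<alpha>_def)
  qed
  have Re_\<alpha>: "Re (\<alpha> t) > 0" if "t \<in> {0..T}" for t
    using \<alpha>_near [OF that] abs_Re_le_cmod [of "\<alpha> t - 1"] by simp
  have \<alpha>_nonpos: "\<alpha> t \<notin> \<real>\<^sub>\<le>\<^sub>0" "\<alpha> t \<noteq> 0" if "t \<in> {0..T}" for t
    using Re_\<alpha> [OF that] by (auto simp: complex_nonpos_Reals_iff)
  have \<alpha>_cont: "continuous_on {0..T} \<alpha>"
    using \<alpha> by (meson continuous_at_imp_continuous_on has_vector_derivative_continuous)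
  have "\<bar>(Im (q2 T) - Im (q2 0)) - (Im (q1 T + Ln (\<alpha> T)) - Im (q1 0 + Ln (\<alpha> 0)))\<bar> < pi"
  proof (rule lift_displacement_less_pi [OF T(1)])
    show "continuous_on {0..T} q2" by (rule continuous_on_subset [OF q2(1)]) auto
    show "continuous_on {0..T} (\<lambda>t. q1 t + Ln (\<alpha> t))"
      using \<alpha>_nonpos by (intro continuous_intros continuous_on_subset [OF q1(1)] \<alpha>_cont) auto
    fix t assume t: "t \<in> {0..T}"
    \<comment> \<open>The antilinear coefficient of the same relative factor; determinant 1 makes it
      smaller in norm than \<open>\<alpha> t\<close>.\<close>
    define w where "w = cnj (a1 t) * b2 t - b1 t * cnj (a2 t)"
    have e1: "exp (q1 t + Ln (\<alpha> t)) = a1 t * \<alpha> t"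
      using \<alpha>_nonpos(2) [OF t] by (simp add: exp_add q1(2))
    have "a1 t * \<alpha> t + b1 t * cnj w = (a1 t * cnj (a1 t) - b1 t * cnj (b1 t)) * a2 t"
      by (simp add: \<alpha>_def w_def algebra_simps)
    then have e2: "a2 t = a1 t * \<alpha> t + b1 t * cnj w"
      by (simp add: fund_det [OF f1])
    have "\<alpha> t * cnj (\<alpha> t) - w * cnj w =
        (a1 t * cnj (a1 t) - b1 t * cnj (b1 t)) * (a2 t * cnj (a2 t) - b2 t * cnj (b2 t))"
      by (simp add: \<alpha>_def w_def algebra_simps)
    then have "\<alpha> t * cnj (\<alpha> t) - w * cnj w = 1"
      by (simp add: fund_det [OF f1] fund_det [OF f2])
    then have "complex_of_real ((norm (\<alpha> t))\<^sup>2 - (norm w)\<^sup>2) = 1"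
      unfolding of_real_diff complex_norm_square .
    then have "(norm (\<alpha> t))\<^sup>2 - (norm w)\<^sup>2 = 1" by (simp only: of_real_eq_1_iff)
    then have "(norm w)\<^sup>2 < (norm (\<alpha> t))\<^sup>2" by simp
    then have "norm w < norm (\<alpha> t)" by (rule power2_less_imp_less) simp
    then have "norm (b1 t) * norm w < norm (a1 t) * norm (\<alpha> t)"
      using fund_norm_less [OF f1, of t] by (intro mult_strict_mono') auto
    then show "norm (exp (q2 t) - exp (q1 t + Ln (\<alpha> t))) < norm (exp (q1 t + Ln (\<alpha> t)))"
      unfolding e1 q2(2) [symmetric] by (simp add: e2 norm_mult)
  qed
  moreover have "\<alpha> 0 = 1" using fund_init [OF f1] fund_init [OF f2] by (simp add: \<alpha>_def)
  moreover have "\<bar>Im (Ln (\<alpha> T))\<bar> < pi/2"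
    using Re_\<alpha> [of T] T(1) by (intro Re_Ln_pos_lt_imp) auto
  ultimately show ?thesis using pi_gt_zero by simp
qed

text \<open>Restarting the system at s and at s + \<tau> costs pi each, and comparing the two
  restarted systems costs 2 pi. The total does not depend on \<open>T\<close>; only the admissible
  \<open>\<delta>\<close> does.\<close>

lemma fund_almost_period:
  assumes f: "complex_fundamental h k a b"
    and q: "continuous_on UNIV q" "\<And>t. a t = exp (q t)"
    and K: "\<And>t. norm (k t) \<le> K"
    and \<delta>: "\<And>t. \<bar>h (t + \<tau>) - h t\<bar> \<le> \<delta>" "\<And>t. norm (k (t + \<tau>) - k t) \<le> \<delta>"
    and T: "T \<ge> 0" "2 * \<delta> * exp (2 * K * T) * T < 1"
  shows "\<bar>(Im (q (s + \<tau> + T)) - Im (q (s + \<tau>))) - (Im (q (s + T)) - Im (q s))\<bar> < 4 * pi"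
proof -
  obtain p where p: "continuous_on UNIV p" "\<And>t. a (s + t) * cnj (a s) - b (s + t) * cnj (b s) = exp (p t)"
    using fund_lift [OF fund_shift [OF f, of s]] by metis
  obtain p' where p': "continuous_on UNIV p'"
      "\<And>t. a (s + \<tau> + t) * cnj (a (s + \<tau>)) - b (s + \<tau> + t) * cnj (b (s + \<tau>)) = exp (p' t)"
    using fund_lift [OF fund_shift [OF f, of "s + \<tau>"]] by metis
  have "\<bar>(Im (p' T) - Im (p' 0)) - (Im (p T) - Im (p 0))\<bar> < 2 * pi"
    by (rule fund_compare [OF fund_shift [OF f, of s] fund_shift [OF f, of "s + \<tau>"] K K _ _ T p p'])
      (use \<delta> [of "s + _"] in \<open>simp_all add: add_ac\<close>)
  moreover have "\<bar>(Im (q (s + T)) - Im (q s)) - (Im (p T) - Im (p 0))\<bar> < pi"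
    by (rule fund_shift_displacement [OF f q p T(1)])
  moreover have "\<bar>(Im (q (s + \<tau> + T)) - Im (q (s + \<tau>))) - (Im (p' T) - Im (p' 0))\<bar> < pi"
    by (rule fund_shift_displacement [OF f q p' T(1)])
  ultimately show ?thesis by linarith
qed

subsection \<open>Convergence of the rotation number\<close>

lemma eventually_near_imp_tendsto:
  fixes g :: "real \<Rightarrow> real"
  assumes "\<And>\<eta>. \<eta> > 0 \<Longrightarrow> \<exists>c. eventually (\<lambda>t. \<bar>g t - c\<bar> \<le> \<eta>) at_top"
  shows "\<exists>R. (g \<longlongrightarrow> R) at_top"
proof -
  have "cauchy_filter (filtermap g at_top)"
    unfolding cauchy_filter_metric_filtermap
  proof (intro allI impI)
    fix e :: real assume "e > 0"
    then obtain c where c: "eventually (\<lambda>t. \<bar>g t - c\<bar> \<le> e/3) at_top"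
      using assms [of "e/3"] by auto
    show "\<exists>P. eventually P at_top \<and> (\<forall>x y. P x \<and> P y \<longrightarrow> dist (g x) (g y) < e)"
    proof (intro exI conjI allI impI)
      show "eventually (\<lambda>t. \<bar>g t - c\<bar> \<le> e/3) at_top" by (rule c)
      fix x y assume "\<bar>g x - c\<bar> \<le> e/3 \<and> \<bar>g y - c\<bar> \<le> e/3"
      then have "\<bar>g x - g y\<bar> \<le> 2 * (e/3)" by linarith
      then show "dist (g x) (g y) < e" using \<open>e > 0\<close> by (simp add: dist_real_def)
    qed
  qed
  then obtain c where "filtermap g at_top \<le> nhds c"
    using cauchy_filter_complete_converges [OF _ complete_UNIV, of "filtermap g at_top"]
    by (auto simp: filtermap_bot_iff)
  then show ?thesis by (auto simp: filterlim_def)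
qed

lemma floor_division:
  fixes t L :: real
  assumes "t \<ge> 0" "L > 0"
  obtains n :: nat where "real n * L \<le> t" "t < real n * L + L"
proof -
  define n where "n = nat \<lfloor>t / L\<rfloor>"
  have "real n = of_int \<lfloor>t / L\<rfloor>" using assms by (simp add: n_def)
  then have "real n \<le> t / L" "t / L < real n + 1" by linarith+
  then show ?thesis using assms by (intro that [of n]) (auto simp: field_simps)
qed

text \<open>The constant \<open>C\<close> is the same for all window lengths, so it can be made
  small relative to the window. The almost period moves any long interval close to one starting at 0
  before the interval is cut into windows; displacements over intervals of a fixed long length are
  then nearly equal, and their averages converge.\<close>

lemma almost_periodic_displacement_converges:
  fixes \<phi> :: "real \<Rightarrow> real"
  assumes Lip: "\<And>s t. \<bar>\<phi> t - \<phi> s\<bar> \<le> K * \<bar>t - s\<bar>"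
    and ap: "\<And>T. T > 0 \<Longrightarrow> \<exists>l. \<forall>a\<ge>0. \<exists>\<tau>. a \<le> \<tau> \<and> \<tau> \<le> a + l \<and>
      (\<forall>s. \<bar>(\<phi> (s + \<tau> + T) - \<phi> (s + \<tau>)) - (\<phi> (s + T) - \<phi> s)\<bar> \<le> C)"
  shows "\<exists>R. ((\<lambda>t. \<phi> t / t) \<longlongrightarrow> R) at_top"
proof -
  have K0: "K \<ge> 0" using Lip [of 1 0] by simp
  have C0: "C \<ge> 0"
  proof -
    obtain \<tau> where "\<bar>(\<phi> (0 + \<tau> + 1) - \<phi> (0 + \<tau>)) - (\<phi> (0 + 1) - \<phi> 0)\<bar> \<le> C"
      using ap [of 1] by (metis order_refl zero_less_one)
    then show ?thesis by linarith
  qed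
  have uniform: "\<exists>L>0. \<forall>a\<ge>0. \<bar>(\<phi> (a + L) - \<phi> a) - (\<phi> L - \<phi> 0)\<bar> \<le> \<eta> * L" if \<eta>: "\<eta> > 0" for \<eta>
  proof -
    \<comment> \<open>Windows so long that the error \<open>C\<close> per window is at most
      \<open>\<eta>/2\<close> per unit of time.\<close>
    define T where "T = 2 * C / \<eta> + 1"
    have T: "T > 0" "C \<le> \<eta> * T / 2" using C0 \<eta> by (auto simp: T_def add_nonneg_pos field_simps)
    obtain l where l: "\<And>a. a \<ge> 0 \<Longrightarrow> \<exists>\<tau>. a \<le> \<tau> \<and> \<tau> \<le> a + l \<and>
      (\<forall>s. \<bar>(\<phi> (s + \<tau> + T) - \<phi> (s + \<tau>)) - (\<phi> (s + T) - \<phi> s)\<bar> \<le> C)"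
      using ap [OF T(1)] by blast
    have l0: "l \<ge> 0" using l [of 0] by auto
    \<comment> \<open>Moving both ends from \<open>a\<close> to \<tau> costs at most 2 K l, and
      dropping the incomplete last windows 2 K T; the length \<open>L\<close> makes these together
      at most half of \<open>\<eta> * L\<close>.\<close>
    define L where "L = (4 * K * l + 4 * K * T) / \<eta> + 1"
    have "(4 * K * l + 4 * K * T) / \<eta> \<ge> 0"
      using K0 l0 T(1) \<eta> by (intro divide_nonneg_nonneg add_nonneg_nonneg mult_nonneg_nonneg) auto
    then have L: "L > 0" "2 * K * l + 2 * K * T \<le> \<eta> * L / 2"
      using K0 l0 T(1) \<eta> unfolding L_def by (linarith, simp add: field_simps)
    have "\<bar>(\<phi> (a + L) - \<phi> a) - (\<phi> L - \<phi> 0)\<bar> \<le> \<eta> * L" if a: "a \<ge> 0" for a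
    proof -
      obtain \<tau> where \<tau>: "a \<le> \<tau>" "\<tau> \<le> a + l"
        "\<And>s. \<bar>(\<phi> (s + \<tau> + T) - \<phi> (s + \<tau>)) - (\<phi> (s + T) - \<phi> s)\<bar> \<le> C"
        using l [OF a] by blast
      obtain n :: nat where n: "real n * T \<le> L" "L < real n * T + T"
        using floor_division [of L T] L T by auto
      \<comment> \<open>The same almost period serves for all windows: the hypothesis is applied at
        s = j T and the displacements telescope.\<close>
      have sum: "\<bar>(\<phi> (real j * T + \<tau>) - \<phi> \<tau>) - (\<phi> (real j * T) - \<phi> 0)\<bar> \<le> real j * C" for j
      proof (induction j)
        case (Suc j)
        have "real (Suc j) * T + \<tau> = real j * T + \<tau> + T" "real (Suc j) * T = real j * T + T"
          "real (Suc j) * C = real j * C + C"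
          by (simp_all add: algebra_simps)
        then show ?case using Suc \<tau>(3) [of "real j * T"] by (simp only:)
      qed simp
      have "\<bar>\<phi> (a + L) - \<phi> (\<tau> + L)\<bar> \<le> K * l" "\<bar>\<phi> a - \<phi> \<tau>\<bar> \<le> K * l"
        using Lip [of "a + L" "\<tau> + L"] Lip [of a \<tau>] \<tau>(1,2) K0 mult_left_mono [of "\<bar>a - \<tau>\<bar>" l K] by auto
      moreover have "K * \<bar>L - real n * T\<bar> \<le> K * T" using n K0 by (intro mult_left_mono) auto
      then have "\<bar>\<phi> (\<tau> + L) - \<phi> (real n * T + \<tau>)\<bar> \<le> K * T" "\<bar>\<phi> L - \<phi> (real n * T)\<bar> \<le> K * T"
        using Lip [of "\<tau> + L" "real n * T + \<tau>"] Lip [of L "real n * T"] by auto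
      moreover have "real n * C \<le> \<eta> * L / 2"
      proof -
        have "real n * C \<le> real n * (\<eta> * T / 2)" using T(2) by (intro mult_left_mono) auto
        also have "\<dots> = \<eta> / 2 * (real n * T)" by simp
        also have "\<dots> \<le> \<eta> / 2 * L" using n(1) \<eta> by (intro mult_left_mono) auto
        finally show ?thesis by simp
      qed
      ultimately show ?thesis using sum [of n] L(2) by linarith
    qed
    then show ?thesis using L(1) by blast
  qed
  show ?thesis
  proof (rule eventually_near_imp_tendsto)
    fix \<eta> :: real assume \<eta>: "\<eta> > 0"
    obtain L where L: "L > 0" "\<And>a. a \<ge> 0 \<Longrightarrow> \<bar>(\<phi> (a + L) - \<phi> a) - (\<phi> L - \<phi> 0)\<bar> \<le> \<eta>/2 * L"
      using uniform [of "\<eta>/2"] \<eta> by auto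
    define D where "D = \<phi> L - \<phi> 0"
    have D: "\<bar>D\<bar> \<le> K * L" using Lip [of L 0] L(1) by (simp add: D_def)
    have mult: "\<bar>\<phi> (real n * L) - \<phi> 0 - real n * D\<bar> \<le> real n * (\<eta>/2 * L)" for n
    proof (induction n)
      case (Suc n)
      have eqs: "real (Suc n) * L = real n * L + L" "real (Suc n) * D = real n * D + D"
        "real (Suc n) * (\<eta>/2 * L) = real n * (\<eta>/2 * L) + \<eta>/2 * L"
        by (simp_all add: algebra_simps)
      have "\<bar>(\<phi> (real n * L + L) - \<phi> (real n * L)) - D\<bar> \<le> \<eta>/2 * L"
        using L by (simp add: D_def)
      then show ?case unfolding eqs using Suc by linarith
    qed simp
    \<comment> \<open>The threshold for t absorbs the initial value, the incomplete last block, and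
      the error of replacing the number of blocks by t / L; each of the last two costs at most K
      L.\<close>
    have near: "\<bar>\<phi> t / t - D / L\<bar> \<le> \<eta>" if t: "t > 0" "t \<ge> (\<bar>\<phi> 0\<bar> + 2 * K * L) / (\<eta>/2)" for t
    proof -
      obtain n :: nat where n: "real n * L \<le> t" "t < real n * L + L"
        using floor_division [of t L] L t by auto
      have "K * \<bar>t - real n * L\<bar> \<le> K * L" using n K0 by (intro mult_left_mono) auto
      then have 1: "\<bar>\<phi> t - \<phi> (real n * L)\<bar> \<le> K * L" using Lip [of t "real n * L"] by linarith
      have "\<bar>real n - t / L\<bar> \<le> 1" using n L(1) by (simp add: abs_le_iff field_simps)
      then have "\<bar>real n - t / L\<bar> * \<bar>D\<bar> \<le> 1 * (K * L)" using D by (intro mult_mono) auto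
      then have 2: "\<bar>real n * D - t / L * D\<bar> \<le> K * L" by (simp add: abs_mult [symmetric] left_diff_distrib)
      have "real n * L * (\<eta>/2) \<le> t * (\<eta>/2)" using n(1) \<eta> by (intro mult_right_mono) auto
      then have 3: "\<bar>\<phi> (real n * L) - \<phi> 0 - real n * D\<bar> \<le> \<eta> * t / 2"
        using mult [of n] by (simp add: mult_ac)
      have 4: "\<bar>\<phi> 0\<bar> + 2 * (K * L) \<le> \<eta> * t / 2" using t(2) \<eta> by (simp add: field_simps)
      have "\<bar>\<phi> t - t / L * D\<bar> \<le> \<eta> * t"
        using 1 2 3 4 abs_ge_self [of "\<phi> 0"] abs_ge_minus_self [of "\<phi> 0"] unfolding abs_le_iff by linarith
      moreover have "\<phi> t / t - D / L = (\<phi> t - t / L * D) / t" using t(1) L(1) by (simp add: field_simps)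
      ultimately show ?thesis using t(1) by (simp add: abs_divide divide_le_eq)
    qed
    have "eventually (\<lambda>t. t > 0 \<and> t \<ge> (\<bar>\<phi> 0\<bar> + 2 * K * L) / (\<eta>/2)) at_top"
      by (intro eventually_conj eventually_gt_at_top eventually_ge_at_top)
    then have "eventually (\<lambda>t. \<bar>\<phi> t / t - D / L\<bar> \<le> \<eta>) at_top"
      by eventually_elim (use near in auto)
    then show "\<exists>c. eventually (\<lambda>t. \<bar>\<phi> t / t - c\<bar> \<le> \<eta>) at_top" by blast
  qed
qed

subsection \<open>Almost periods of quasi-periodic functions\<close>

definition floor_vec :: "real^'m \<Rightarrow> real^'m" where
  "floor_vec x = (\<chi> i. of_int \<lfloor>x $ i\<rfloor>)"

lemma torus_periodic_int:
  fixes S :: "real^'m \<Rightarrow> 'a::topological_space" and x n :: "real^'m"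
  assumes "continuous_on_torus S" and n: "\<And>i. n $ i \<in> \<int>"
  shows "S (x + n) = S x"
proof -
  have per: "S (x + axis i 1) = S x" for x i
    using assms(1) by (auto simp: continuous_on_torus_def)
  have nat: "S (x + of_nat j *\<^sub>R axis i 1) = S x" for x i and j :: nat
  proof (induction j)
    case (Suc j)
    have "x + of_nat (Suc j) *\<^sub>R axis i 1 = (x + of_nat j *\<^sub>R axis i 1) + axis i (1::real)"
      by (simp add: algebra_simps)
    then show ?case using Suc per by metis
  qed simp
  have int: "S (x + of_int j *\<^sub>R axis i 1) = S x" for x i and j :: int
  proof (cases j)
    case (nonneg m)
    then show ?thesis using nat by simp
  next
    case (neg m)
    have "x = (x + of_int j *\<^sub>R axis i 1) + of_nat (Suc m) *\<^sub>R axis i (1::real)"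
      by (simp add: neg algebra_simps)
    then show ?thesis using nat by metis
  qed
  have "S (x + (\<Sum>i\<in>I. n $ i *\<^sub>R axis i 1)) = S x" if "finite I" for I
    using that
  proof (induction I)
    case (insert i I)
    obtain j :: int where "n $ i = of_int j" using n [of i] by (auto elim: Ints_cases)
    then have "S ((x + (\<Sum>i\<in>I. n $ i *\<^sub>R axis i 1)) + n $ i *\<^sub>R axis i 1) = S x"
      using int insert by simp
    then show ?case using insert by (simp add: algebra_simps)
  qed simp
  moreover have "(\<Sum>i\<in>UNIV. n $ i *\<^sub>R axis i 1) = n"
    using basis_expansion [of n] by (simp add: scalar_mult_eq_scaleR)
  ultimately show ?thesis by (metis finite)
qed

lemma torus_floor:
  assumes "continuous_on_torus S"
  shows "S (x - floor_vec x) = S x"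
  using torus_periodic_int [OF assms, of "floor_vec x" "x - floor_vec x"] by (simp add: floor_vec_def)

lemma minus_floor_vec_in_cube: "x - floor_vec x \<in> cbox 0 1"
  unfolding mem_box_cart floor_vec_def by simp linarith

lemma torus_bounded:
  fixes S :: "real^'m \<Rightarrow> 'a::real_normed_vector"
  assumes S: "continuous_on_torus S"
  obtains M where "\<And>x. norm (S x) \<le> M"
proof -
  have "compact (S ` cbox 0 1)"
    using S by (intro compact_continuous_image compact_cbox) (auto simp: continuous_on_torus_def intro: continuous_on_subset)
  then obtain M where "\<And>y. y \<in> S ` cbox 0 1 \<Longrightarrow> norm y \<le> M"
    using compact_imp_bounded bounded_iff by metis
  then have "norm (S x) \<le> M" for x
    using minus_floor_vec_in_cube [of x] torus_floor [OF S, of x] by (metis imageI)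
  then show ?thesis by (rule that)
qed

lemma torus_uniformly_continuous:
  fixes S :: "real^'m \<Rightarrow> 'a::metric_space"
  assumes S: "continuous_on_torus S" and \<delta>: "\<delta> > 0"
  obtains d where "d > 0" "\<And>x v. norm v < d \<Longrightarrow> dist (S (x + v)) (S x) < \<delta>"
proof -
  \<comment> \<open>The unit cube enlarged by 1 on every side, so that a displacement of norm below
    1 of a point of the cube stays in this compact set.\<close>
  define Q :: "(real^'m) set" where "Q = cbox (\<chi> i. -1) (\<chi> i. 2)"
  have "uniformly_continuous_on Q S"
    unfolding Q_def using S
    by (intro compact_uniformly_continuous compact_cbox) (auto simp: continuous_on_torus_def intro: continuous_on_subset)
  then obtain d where d: "d > 0" "\<And>x y. x \<in> Q \<Longrightarrow> y \<in> Q \<Longrightarrow> dist y x < d \<Longrightarrow> dist (S y) (S x) < \<delta>"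
    using \<delta> unfolding uniformly_continuous_on_def by metis
  show ?thesis
  proof
    show "min d 1 > 0" using d by simp
    fix x v :: "real^'m" assume v: "norm v < min d 1"
    define y where "y = x - floor_vec x"
    have y: "y \<in> cbox 0 1" unfolding y_def by (rule minus_floor_vec_in_cube)
    then have 1: "y \<in> Q" unfolding Q_def mem_box_cart
      by (auto intro: order_trans [of _ 0] order_trans [of _ 1])
    have "\<bar>v $ i\<bar> < 1" for i using component_le_norm_cart [of v i] v by linarith
    then have 2: "y + v \<in> Q" using y unfolding Q_def mem_box_cart
      by (simp add: abs_less_iff) (smt (verit))
    have "dist (S (y + v)) (S y) < \<delta>" using d(2) [OF 1 2] v by (simp add: dist_norm)
    moreover have "S (y + v) = S (x + v)"
      using torus_periodic_int [OF S, of "floor_vec x" "y + v"] by (simp add: y_def floor_vec_def algebra_simps)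
    moreover have "S y = S x" unfolding y_def by (rule torus_floor [OF S])
    ultimately show "dist (S (x + v)) (S x) < \<delta>" by simp
  qed
qed

text \<open>Pigeonhole on a finite cover of the unit cube: the orbit at time \<open>a + l\<close> is close to
  the orbit at one of finitely many times in \<open>[0, l]\<close>.\<close>

lemma torus_almost_periods:
  fixes S :: "real^'m \<Rightarrow> 'a::metric_space"
  assumes S: "continuous_on_torus S" and \<delta>: "\<delta> > 0"
  shows "\<exists>l. \<forall>a\<ge>0. \<exists>\<tau>. a \<le> \<tau> \<and> \<tau> \<le> a + l \<and> (\<forall>x. dist (S (x + \<tau> *\<^sub>R q)) (S x) < \<delta>)"
proof -
  obtain d where d: "d > 0" "\<And>x v. norm v < d \<Longrightarrow> dist (S (x + v)) (S x) < \<delta>"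
    using torus_uniformly_continuous [OF S \<delta>] by metis
  define r where "r t = t *\<^sub>R q - floor_vec (t *\<^sub>R q)" for t
  have "compact (cbox 0 1 :: (real^'m) set)" by (rule compact_cbox)
  \<comment> \<open>Radius d/2, so that two visits to the same ball are less than d apart.\<close>
  then obtain N :: "(real^'m) set" where N: "finite N" "cbox 0 1 \<subseteq> (\<Union>x\<in>N. ball x (d/2))"
    using d(1) unfolding compact_eq_totally_bounded by (metis half_gt_zero)
  \<comment> \<open>One chosen visiting time for each ball; the default 0 for balls never visited
    keeps all summands of l nonnegative.\<close>
  define u where "u x = (if \<exists>t\<ge>0. r t \<in> ball x (d/2) then SOME t. t \<ge> 0 \<and> r t \<in> ball x (d/2) else 0)" for x
  have u: "u x \<ge> 0 \<and> r (u x) \<in> ball x (d/2)" if "t \<ge> 0" "r t \<in> ball x (d/2)" for t x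
  proof -
    have "\<exists>t. t \<ge> 0 \<and> r t \<in> ball x (d/2)" using that by blast
    from someI_ex [OF this] show ?thesis using that unfolding u_def by auto
  qed
  have u0: "u x \<ge> 0" for x
  proof (cases "\<exists>t\<ge>0. r t \<in> ball x (d/2)")
    case True
    then show ?thesis using u by blast
  next
    case False
    then show ?thesis unfolding u_def by (subst if_not_P) auto
  qed
  define l where "l = (\<Sum>x\<in>N. u x)"
  have "\<exists>\<tau>. a \<le> \<tau> \<and> \<tau> \<le> a + l \<and> (\<forall>x. dist (S (x + \<tau> *\<^sub>R q)) (S x) < \<delta>)" if a: "a \<ge> 0" for a
  proof -
    \<comment> \<open>Going l beyond a leaves room to subtract the earlier visiting time, which lies
      between 0 and l, so that the difference falls into the required interval.\<close>
    define t where "t = a + l"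
    have t0: "t \<ge> 0" using a u0 by (simp add: t_def l_def sum_nonneg)
    have "r t \<in> cbox 0 1" unfolding r_def by (rule minus_floor_vec_in_cube)
    then obtain y where y: "y \<in> N" "r t \<in> ball y (d/2)" using N(2) by blast
    have uy: "r (u y) \<in> ball y (d/2)" using u [OF t0 y(2)] by blast
    have ul: "u y \<le> l" unfolding l_def using N(1) y(1) u0 by (intro member_le_sum) auto
    define v where "v = r t - r (u y)"
    have "dist (r t) (r (u y)) < d"
      using y(2) uy dist_triangle_half_r [of y "r t" d "r (u y)"] by simp
    then have v: "norm v < d" by (simp add: v_def dist_norm)
    have "dist (S (x + (t - u y) *\<^sub>R q)) (S x) < \<delta>" for x
    proof -
      define n where "n = floor_vec (t *\<^sub>R q) - floor_vec (u y *\<^sub>R q)"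
      have "x + (t - u y) *\<^sub>R q = (x + v) + n"
        by (simp add: v_def n_def r_def scaleR_diff_left)
      moreover have "S ((x + v) + n) = S (x + v)"
        by (rule torus_periodic_int [OF S]) (simp add: n_def floor_vec_def)
      ultimately have "S (x + (t - u y) *\<^sub>R q) = S (x + v)" by (simp only:)
      then show ?thesis using d(2) [OF v, of x] by simp
    qed
    then show ?thesis
      using ul u0 [of y] by (intro exI [of _ "t - u y"]) (auto simp: t_def)
  qed
  then show ?thesis by blast
qed

subsection \<open>Mean index and rotation number\<close>

lemma symmetric_clin_real:
  assumes "transpose M = M"
  shows "clin M = of_real (Re (clin M))"
proof -
  have "transpose M $ 1 $ 2 = M $ 1 $ 2" by (simp add: assms)
  then show ?thesis by (simp add: clin_def complex_eq_iff transpose_def)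
qed

lemma complex_fundamental_of_fundamental_solution:
  assumes fs: "fundamental_solution B \<gamma>" and sym: "\<And>t. transpose (B t) = B t"
  shows "complex_fundamental (\<lambda>t. Re (clin (B t))) (\<lambda>t. alin (B t)) (\<lambda>t. clin (\<gamma> t)) (\<lambda>t. alin (\<gamma> t))"
proof -
  have deriv: "(\<gamma> has_vector_derivative J ** B t ** \<gamma> t) (at t)" for t
    using fs by (simp add: fundamental_solution_def)
  have eq: "clin (B t) = of_real (Re (clin (B t)))" for t by (rule symmetric_clin_real [OF sym])
  have c: "clin (J ** B t ** \<gamma> t) = \<i> * (of_real (Re (clin (B t))) * clin (\<gamma> t) + alin (B t) * cnj (alin (\<gamma> t)))"
    and a: "alin (J ** B t ** \<gamma> t) = \<i> * (of_real (Re (clin (B t))) * alin (\<gamma> t) + alin (B t) * cnj (clin (\<gamma> t)))" for t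
    unfolding eq [symmetric] by (simp_all add: clin_mult alin_mult algebra_simps)
  show ?thesis
    unfolding complex_fundamental_def c [symmetric] a [symmetric]
    using fs bounded_linear.has_vector_derivative [OF bounded_linear_clin deriv]
      bounded_linear.has_vector_derivative [OF bounded_linear_alin deriv]
    by (simp add: fundamental_solution_def)
qed

lemma continuous_on_torus_compose:
  assumes "continuous_on_torus S" "continuous_on UNIV f"
  shows "continuous_on_torus (\<lambda>x. f (S x))"
  using assms unfolding continuous_on_torus_def
  by (auto intro: continuous_on_compose2)

theorem theorem3p5:
  fixes S :: "real^'m \<Rightarrow> real^2^2"
    and p q :: "real^'m"
    and B \<gamma> :: "real \<Rightarrow> real^2^2"
  assumes "continuous_on_torus S"
    and "\<And>x. transpose (S x) = S x"
    and "rationally_independent q"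
    and "\<And>t. B t = S (p + t *\<^sub>R q)"
    and "fundamental_solution B \<gamma>"
  shows "\<exists>\<mu> R :: real. mean_index \<gamma> = {ereal \<mu>} \<and> has_rotation_number B R \<and> pi * \<mu> = R"
proof -
  have sym: "transpose (B t) = B t" for t by (simp add: assms(2,4))
  define h k a b where "h t = Re (clin (B t))" and "k t = alin (B t)"
    and "a t = clin (\<gamma> t)" and "b t = alin (\<gamma> t)" for t
  have fund: "complex_fundamental h k a b"
    using complex_fundamental_of_fundamental_solution [OF assms(5) sym]
    unfolding h_def [abs_def] k_def [abs_def] a_def [abs_def] b_def [abs_def] .
  obtain u where u: "continuous_on UNIV u" "\<And>t. a t = exp (u t)" "u 0 = 0"
    using fund_lift [OF fund] by metis
  define \<phi> where "\<phi> t = Im (u t)" for t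
  \<comment> \<open>Both coefficients are bundled into one torus function, so that a single almost
    period serves \<open>h\<close> and \<open>k\<close> at once.\<close>
  have torus: "continuous_on_torus (\<lambda>x. (clin (S x), alin (S x)))"
    by (intro continuous_on_torus_compose [OF assms(1), of "\<lambda>M. (clin M, alin M)"] continuous_on_Pair
        linear_continuous_on bounded_linear_clin bounded_linear_alin)
  obtain K where K: "\<And>x. norm (clin (S x), alin (S x)) \<le> K"
    using torus_bounded [OF torus] by metis
  have hk: "\<bar>h t\<bar> \<le> K" "norm (k t) \<le> K" for t
  proof -
    have "norm (clin (B t)) \<le> K" "norm (alin (B t)) \<le> K"
      using K [of "p + t *\<^sub>R q"] norm_fst_le [of "clin (B t)" "alin (B t)"] norm_snd_le [of "alin (B t)" "clin (B t)"]
      by (auto simp: assms(4))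
    then show "\<bar>h t\<bar> \<le> K" "norm (k t) \<le> K"
      using abs_Re_le_cmod [of "clin (B t)"] by (auto simp: h_def k_def)
  qed
  have "\<exists>R. ((\<lambda>t. \<phi> t / t) \<longlongrightarrow> R) at_top"
  proof (rule almost_periodic_displacement_converges)
    show "\<bar>\<phi> t - \<phi> s\<bar> \<le> (2 * K) * \<bar>t - s\<bar>" for s t
      unfolding \<phi>_def by (rule fund_lift_Lipschitz [OF fund u(1,2) hk])
    fix T :: real assume T: "T > 0"
    \<comment> \<open>This makes the quantity in the smallness condition of
      \<open>fund_almost_period\<close> equal to 1/2. The tolerance depends on \<open>T\<close>, but
      the resulting bound 4 pi does not.\<close>
    define \<delta> where "\<delta> = 1 / (4 * exp (2 * K * T) * T)"
    have \<delta>: "\<delta> > 0" "2 * \<delta> * exp (2 * K * T) * T < 1" using T by (simp_all add: \<delta>_def)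
    obtain l where l: "\<forall>a\<ge>0. \<exists>\<tau>. a \<le> \<tau> \<and> \<tau> \<le> a + l \<and>
        (\<forall>x. dist (clin (S (x + \<tau> *\<^sub>R q)), alin (S (x + \<tau> *\<^sub>R q))) (clin (S x), alin (S x)) < \<delta>)"
      using torus_almost_periods [OF torus \<delta>(1), of q] by auto
    have "\<bar>(\<phi> (s + \<tau> + T) - \<phi> (s + \<tau>)) - (\<phi> (s + T) - \<phi> s)\<bar> \<le> 4 * pi"
      if \<tau>: "\<forall>x. dist (clin (S (x + \<tau> *\<^sub>R q)), alin (S (x + \<tau> *\<^sub>R q))) (clin (S x), alin (S x)) < \<delta>" for \<tau> s
    proof -
      have d: "dist (clin (B (t + \<tau>))) (clin (B t)) < \<delta>" "dist (alin (B (t + \<tau>))) (alin (B t)) < \<delta>" for t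
      proof -
        have eq: "B (t + \<tau>) = S (p + t *\<^sub>R q + \<tau> *\<^sub>R q)" "B t = S (p + t *\<^sub>R q)"
          by (simp_all add: assms(4) algebra_simps)
        show "dist (clin (B (t + \<tau>))) (clin (B t)) < \<delta>" "dist (alin (B (t + \<tau>))) (alin (B t)) < \<delta>"
          using \<tau> [rule_format, of "p + t *\<^sub>R q"]
            dist_fst_le [of "(clin (B (t + \<tau>)), alin (B (t + \<tau>)))" "(clin (B t), alin (B t))"]
            dist_snd_le [of "(clin (B (t + \<tau>)), alin (B (t + \<tau>)))" "(clin (B t), alin (B t))"]
          unfolding eq by auto
      qed
      have dh: "\<bar>h (t + \<tau>) - h t\<bar> \<le> \<delta>" and dk: "norm (k (t + \<tau>) - k t) \<le> \<delta>" for t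
        using d [of t] abs_Re_le_cmod [of "clin (B (t + \<tau>)) - clin (B t)"]
        by (auto simp: h_def k_def dist_norm)
      show ?thesis
        unfolding \<phi>_def using fund_almost_period [OF fund u(1,2) hk(2) dh dk _ \<delta>(2), of s] T
        by (simp add: less_imp_le)
    qed
    then show "\<exists>l. \<forall>a\<ge>0. \<exists>\<tau>. a \<le> \<tau> \<and> \<tau> \<le> a + l \<and>
        (\<forall>s. \<bar>(\<phi> (s + \<tau> + T) - \<phi> (s + \<tau>)) - (\<phi> (s + T) - \<phi> s)\<bar> \<le> 4 * pi)"
      using l by meson
  qed
  then obtain R where R: "((\<lambda>t. \<phi> t / t) \<longlongrightarrow> R) at_top" by blast
  \<comment> \<open>Functions at bounded distance have the same growth rate. This is used twice: for
    the index against the angle divided by pi, and for the argument of a solution against the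
    angle.\<close>
  have close: "((\<lambda>t. f t / t) \<longlongrightarrow> R') at_top"
    if "\<And>t. t \<ge> 0 \<Longrightarrow> \<bar>f t - g t\<bar> \<le> C" "((\<lambda>t. g t / t) \<longlongrightarrow> R') at_top" for f g :: "real \<Rightarrow> real" and C R'
  proof -
    have "((\<lambda>t. (f t - g t) / t) \<longlongrightarrow> 0) at_top"
    proof (rule Lim_null_comparison)
      show "eventually (\<lambda>t. norm ((f t - g t) / t) \<le> C / t) at_top"
        using eventually_gt_at_top [of 0]
        by eventually_elim (use that(1) in \<open>simp add: abs_divide divide_right_mono\<close>)
      show "((\<lambda>t. C / t) \<longlongrightarrow> 0) at_top"
        by (intro tendsto_divide_0 [OF tendsto_const] filterlim_at_top_imp_at_infinity filterlim_ident)
    qed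
    from tendsto_add [OF this that(2)] show ?thesis by (simp add: diff_divide_distrib)
  qed
  have "((\<lambda>l. real_of_int (maslov_index \<gamma> l) / l) \<longlongrightarrow> R / pi) at_top"
  proof (rule close)
    show "((\<lambda>t. (\<phi> t / pi) / t) \<longlongrightarrow> R / pi) at_top"
      using tendsto_divide [OF R tendsto_const, of pi] by (simp add: field_simps)
    fix T :: real assume T: "T \<ge> 0"
    show "\<bar>real_of_int (maslov_index \<gamma> T) - \<phi> T / pi\<bar> \<le> 2"
      unfolding \<phi>_def
    proof (rule maslov_index_estimate [OF T])
      show "continuous_on {0..T} \<gamma>"
        using assms(5) unfolding fundamental_solution_def
        by (meson continuous_at_imp_continuous_on has_vector_derivative_continuous)
      show "\<gamma> t \<in> Sp2" for t
        using fund_norm [OF fund, of t] by (simp add: mem_Sp2_iff a_def b_def)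
      show "\<gamma> 0 = mat 1" using assms(5) by (simp add: fundamental_solution_def)
      show "continuous_on {0..T} u" by (rule continuous_on_subset [OF u(1)]) auto
    qed (use u in \<open>auto simp: a_def\<close>)
  qed
  then have "((\<lambda>l. ereal (real_of_int (maslov_index \<gamma> l) / l)) \<longlongrightarrow> ereal (R / pi)) at_top"
    by (simp add: tendsto_ereal)
  then have "mean_index_upper \<gamma> = ereal (R / pi)" "mean_index_lower \<gamma> = ereal (R / pi)"
    unfolding mean_index_upper_def mean_index_lower_def
    by (intro lim_imp_Limsup lim_imp_Liminf; simp)+
  then have "mean_index \<gamma> = {ereal (R / pi)}" by (simp add: mean_index_def)
  moreover have "has_rotation_number B R"
    unfolding has_rotation_number_def
  proof (intro allI impI)
    fix z \<theta> assume z: "nonzero_solution B z" and \<theta>: "argument_lift z \<theta>"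
    have zd: "((\<lambda>t. zvec (z t)) has_vector_derivative
        \<i> * (of_real (h t) * zvec (z t) + k t * cnj (zvec (z t)))) (at t)" for t
    proof -
      have "(z has_vector_derivative (J ** B t) *v z t) (at t)"
        using z by (simp add: nonzero_solution_def)
      from bounded_linear.has_vector_derivative [OF bounded_linear_zvec this]
      show ?thesis
        unfolding h_def k_def symmetric_clin_real [OF sym, symmetric]
        by (rule has_vector_derivative_eq_rhs) (simp add: zvec_mult clin_mult alin_mult algebra_simps)
    qed
    obtain s where s: "zvec (z s) \<noteq> 0"
      using z by (auto simp: nonzero_solution_def zvec_eq_0_iff)
    show "((\<lambda>t. \<theta> t / t) \<longlongrightarrow> R) at_top"
    proof (rule close [OF _ R])
      fix T :: real assume T: "T \<ge> 0"
      have "\<bar>(\<theta> T - \<theta> 0) - (Im (u T) - Im (u 0))\<bar> < pi"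
        by (rule fund_solution_displacement [OF fund u(1,2) zd s _ _ T])
          (use \<theta> in \<open>auto simp: argument_lift_def zvec_def\<close>)
      then show "\<bar>\<theta> T - \<phi> T\<bar> \<le> pi + \<bar>\<theta> 0\<bar>"
        using u(3) by (simp add: \<phi>_def)
    qed
  qed
  ultimately show ?thesis
    by (intro exI [of _ "R / pi"] exI [of _ R]) simp
qed

end
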